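(* Assume $P_{X,Y}$ satisfies Assumptions (A1), (A2), (A3) stated in the context. Let $\mathcal{V}$ denote the VC dimension of the class of balls on $\mathcal{X}$. There exist constants $C_1, C_2$ depending on $P_{X,Y}$ (and not on $n,m,I,\delta$) such that the following holds for all $n\ge 1$, $1\le m\le n$, $I\ge 1$ and $0<\delta<1$. With probability at least $1-L\delta$ (over $(\mathbf{X},\mathbf{Y})$ and the subsamples), there exists a choice of $k\in[n]$ such that the subNN estimate $\bar h$ (built from $I$ independent subsamples of size $m$, denoised with this $k$) satisfies $$\mathrm{err}(\bar h)-\mathrm{err}(h^* )\le C_1\left(\frac{\mathcal{V}\ln(Ln/\delta)}{n}\right)^{\alpha(\beta+1)/(2\alpha+d)}+C_2\left(\frac{\mathcal{V}\ln(m/\delta)}{m}\right)^{\alpha(\beta+1)/d}.$$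
   Context: Data. $\mathcal{X}\subset\mathbb{R}^D$ with Euclidean norm $\|\cdot\|$; $L\ge 2$ is an integer, $[L]=\{1,\dots,L\}$. $(\mathbf{X},\mathbf{Y})=(X_i,Y_i)_{i=1}^n$ is an i.i.d. sample from a distribution $P_{X,Y}$ on $\mathcal{X}\times[L]$, with marginal $P_X$. The regression function is $\eta:\mathcal{X}\to[0,1]^L$, $\eta_l(x)=\mathbb{P}(Y=l\mid X=x)$. Balls are $B(x,r)=\{x'\in\mathcal{X}:\|x-x'\|\le r\}$, $x\in\mathcal{X}$, $r>0$. (A1) $\mathcal{X}$ has finite positive diameter $\mathrm{diam}(\mathcal{X})$, and there exist an integer $d\ge1$ and a constant $C_d>0$ such that $P_X(B(x,r))\ge C_d r^d$ for all $x\in\mathcal{X}$ and all $0<r\le\mathrm{diam}(\mathcal{X})$. (A2) There are $\lambda>0$ and $0<\alpha\le1$ such that $\|\eta(x)-\eta(x')\|_\infty\le\lambda\|x-x'\|^\alpha$ for all $x,x'\in\mathcal{X}$. (A3) Let $\eta_{(l)}(x)$ denote the $l$-th largest element of $\{\eta_l(x)\}_{l=1}^L$. There are $\beta>0$ and $C_\beta>0$ such that $\mathbb{P}(|\eta_{(1)}(X)-\eta_{(2)}(X)|\le t)\le C_\beta t^\beta$ for all $t>0$. Classification. For a classifier $h:\mathcal{X}\to[L]$, $\mathrm{err}(h)=\mathbb{P}_{X,Y}(h(X)\ne Y)$ (for a data-dependent $h$, the probability is over a fresh draw $(X,Y)$ only). The Bayes classifier is $h^*(x)=\arg\max_l\eta_l(x)$.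 $k$-NN. For $k\in[n]$, $k\text{NN-I}(x)$ is the set of indices of the $k$ nearest neighbors of $x$ in $\mathbf{X}$ (ties resolved so that it has exactly $k$ elements). Define $\hat\eta_l(x)=\frac1k\sum_{i\in k\text{NN-I}(x)}\mathbf{1}\{Y_i=l\}$ and $h_{\hat\eta}(x)=\arg\max_l\hat\eta_l(x)$ (ties in arg max broken by a fixed rule). Denoised 1-NN and subNN. For a random subsample $\mathbf{X}'$ of $\mathbf{X}$ of size $m\le n$, drawn uniformly without replacement, independently of the data values, let $\mathrm{NN}(\mathbf{X}';x)$ be the nearest neighbor of $x$ in $\mathbf{X}'$. The denoised 1-NN estimate is $\hat h(x)=h_{\hat\eta}(\mathrm{NN}(\mathbf{X}';x))$. Given $I$ such subsamples $\mathbf{X}'_1,\dots,\mathbf{X}'_I$ (the $I$ index sets are chosen independently of one another), with denoised 1-NN estimators $\hat h_1,\dots,\hat h_I$ (same $k$), the subNN estimate $\bar h(x)$ is the majority (most frequent) label among $\hat h_1(x),\dots,\hat h_I(x)$, ties broken by a fixed rule. *)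

theory Defs
  imports "HOL-Probability.Probability"
begin

section \<open>VC dimension of balls\<close>

definition shatters :: "'a set set \<Rightarrow> 'a set \<Rightarrow> bool" where
  "shatters \<F> S \<longleftrightarrow> (\<lambda>B. B \<inter> S) ` \<F> = Pow S"

definition vc_dim :: "'a set set \<Rightarrow> enat" where
  "vc_dim \<F> = (SUP S\<in>{S. finite S \<and> shatters \<F> S}. enat (card S))"

definition balls_in :: "'a::metric_space set \<Rightarrow> 'a set set" where
  "balls_in \<X> = {\<X> \<inter> cball x r |x r. x \<in> \<X> \<and> 0 < r}"

text \<open>The VC dimension of the balls on a subset of a Euclidean space is finite, so that
  \<^const>\<open>the_enat\<close> may be applied to it.\<close>

lemma card_shattered_by_balls:
  fixes \<X> S :: "'a::euclidean_space set"
  assumes fin: "finite S" and sh: "shatters (balls_in \<X>) S"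
  shows "card S \<le> DIM('a) + 1"
proof (rule ccontr)
  assume "\<not> card S \<le> DIM('a) + 1"
  then have "affine_dependent S"
    using fin by (intro affine_dependent_biggerset) auto
  then obtain A B where AB: "A \<inter> B = {}" "A \<union> B = S" "convex hull A \<inter> convex hull B \<noteq> {}"
    using Radon_partition[OF fin] by blast
  then obtain z where z: "z \<in> convex hull A" "z \<in> convex hull B" by blast
  have pick: "\<exists>c r. S \<inter> cball c r = T" if "T \<subseteq> S" for T
  proof -
    from that sh have "T \<in> (\<lambda>B. B \<inter> S) ` balls_in \<X>" by (auto simp: shatters_def)
    then obtain c r where T: "T = \<X> \<inter> cball c r \<inter> S" by (auto simp: balls_in_def)
    from sh have "S \<in> (\<lambda>B. B \<inter> S) ` balls_in \<X>" by (auto simp: shatters_def)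
    then have "S \<subseteq> \<X>" by (auto simp: balls_in_def)
    with T have "S \<inter> cball c r = T" by blast
    then show ?thesis by blast
  qed
  obtain a r where a: "S \<inter> cball a r = A" using pick[of A] AB(2) by blast
  obtain b s where b: "S \<inter> cball b s = B" using pick[of B] AB(2) by blast
  define w t where "w = 2 *\<^sub>R (b - a)" and "t = r\<^sup>2 - s\<^sup>2 + (b \<bullet> b - a \<bullet> a)"
  have diff: "(dist a x)\<^sup>2 - r\<^sup>2 - ((dist b x)\<^sup>2 - s\<^sup>2) = w \<bullet> x - t" for x
    by (simp add: w_def t_def dist_norm power2_norm_eq_inner inner_diff inner_commute algebra_simps)
  have in1: "(dist c x)\<^sup>2 \<le> q\<^sup>2" if "x \<in> cball c q" for c x :: 'a and q
    using that by (simp add: power_mono)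
  have out1: "(dist c x)\<^sup>2 > q\<^sup>2" if "x \<notin> cball c q" "0 \<le> q" for c x :: 'a and q
    using that by (simp add: power_strict_mono)
  have ne: "A \<noteq> {}" "B \<noteq> {}" using z by auto
  have r0: "0 \<le> r" using a ne(1) by (metis cball_empty inf_bot_right linorder_not_le)
  have s0: "0 \<le> s" using b ne(2) by (metis cball_empty inf_bot_right linorder_not_le)
  have "w \<bullet> x < t" if "x \<in> A" for x
  proof -
    have "x \<in> cball a r" "x \<notin> cball b s" using that a b AB by blast+
    then show ?thesis using in1[of x a r] out1[of x b s] s0 diff[of x] by linarith
  qed
  then have "A \<subseteq> {x. w \<bullet> x < t}" by blast
  then have "convex hull A \<subseteq> {x. w \<bullet> x < t}"
    by (intro hull_minimal convex_halfspace_lt)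
  moreover have "w \<bullet> x > t" if "x \<in> B" for x
  proof -
    have "x \<in> cball b s" "x \<notin> cball a r" using that a b AB by blast+
    then show ?thesis using in1[of x b s] out1[of x a r] r0 diff[of x] by linarith
  qed
  then have "B \<subseteq> {x. w \<bullet> x > t}" by blast
  then have "convex hull B \<subseteq> {x. w \<bullet> x > t}"
    by (intro hull_minimal convex_halfspace_gt)
  ultimately show False using z by force
qed

lemma vc_dim_balls_in_le:
  fixes \<X> :: "'a::euclidean_space set"
  shows "vc_dim (balls_in \<X>) \<le> enat (DIM('a) + 1)"
  unfolding vc_dim_def using card_shattered_by_balls by (auto intro!: SUP_least)

lemma vc_dim_balls_in_finite:
  fixes \<X> :: "'a::euclidean_space set"
  shows "vc_dim (balls_in \<X>) \<noteq> \<infinity>"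
  using vc_dim_balls_in_le[of \<X>] by (cases "vc_dim (balls_in \<X>)") auto


section \<open>The distribution and the assumptions on it\<close>

text \<open>The set \<open>\<X>\<close> need not be Borel; it carries the trace of the Borel sets.\<close>

definition xy_space :: "'a::euclidean_space set \<Rightarrow> nat \<Rightarrow> ('a \<times> nat) measure" where
  "xy_space \<X> L = restrict_space borel \<X> \<Otimes>\<^sub>M count_space {1..L}"

definition x_marginal :: "'a::euclidean_space set \<Rightarrow> ('a \<times> nat) measure \<Rightarrow> 'a measure" where
  "x_marginal \<X> P = distr P (restrict_space borel \<X>) fst"

text \<open>\<open>\<eta> x l\<close> is a version of the conditional probability of \<open>Y = l\<close> given \<open>X = x\<close>.\<close>

definition regression_function ::
  "'a::euclidean_space set \<Rightarrow> nat \<Rightarrow> ('a \<times> nat) measure \<Rightarrow> ('a \<Rightarrow> nat \<Rightarrow> real) \<Rightarrow> bool" where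
  "regression_function \<X> L P \<eta> \<longleftrightarrow>
     (\<forall>x\<in>\<X>. \<forall>l\<in>{1..L}. 0 \<le> \<eta> x l \<and> \<eta> x l \<le> 1) \<and>
     (\<forall>l\<in>{1..L}. (\<lambda>x. \<eta> x l) \<in> borel_measurable (x_marginal \<X> P) \<and>
        (\<forall>A\<in>sets (x_marginal \<X> P).
           measure P (A \<times> {l}) = (LINT x:A|x_marginal \<X> P. \<eta> x l)))"

definition mass_condition ::
  "'a::euclidean_space set \<Rightarrow> ('a \<times> nat) measure \<Rightarrow> nat \<Rightarrow> real \<Rightarrow> bool" where
  "mass_condition \<X> P d Cd \<longleftrightarrow>
     bounded \<X> \<and> 0 < diameter \<X> \<and> 1 \<le> d \<and> 0 < Cd \<and>
     (\<forall>x\<in>\<X>. \<forall>r. 0 < r \<and> r \<le> diameter \<X> \<longrightarrow>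
        Cd * r ^ d \<le> measure (x_marginal \<X> P) (\<X> \<inter> cball x r))"

definition hoelder_condition ::
  "'a::euclidean_space set \<Rightarrow> nat \<Rightarrow> ('a \<Rightarrow> nat \<Rightarrow> real) \<Rightarrow> real \<Rightarrow> real \<Rightarrow> bool" where
  "hoelder_condition \<X> L \<eta> lam \<alpha> \<longleftrightarrow>
     0 < lam \<and> 0 < \<alpha> \<and> \<alpha> \<le> 1 \<and>
     (\<forall>x\<in>\<X>. \<forall>x'\<in>\<X>.
        (MAX l\<in>{1..L}. \<bar>\<eta> x l - \<eta> x' l\<bar>) \<le> lam * norm (x - x') powr \<alpha>)"

text \<open>The \<open>l\<close>-th largest of \<open>f 1, \<dots>, f L\<close>, counted with multiplicity.\<close>

definition nth_largest :: "nat \<Rightarrow> (nat \<Rightarrow> real) \<Rightarrow> nat \<Rightarrow> real" where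
  "nth_largest L f l = rev (sort (map f [1..<Suc L])) ! (l - 1)"

definition margin_condition ::
  "'a::euclidean_space set \<Rightarrow> nat \<Rightarrow> ('a \<times> nat) measure \<Rightarrow> ('a \<Rightarrow> nat \<Rightarrow> real)
     \<Rightarrow> real \<Rightarrow> real \<Rightarrow> bool" where
  "margin_condition \<X> L P \<eta> \<beta> C\<beta> \<longleftrightarrow>
     0 < \<beta> \<and> 0 < C\<beta> \<and>
     (\<forall>t>0. measure (x_marginal \<X> P)
        {x \<in> \<X>. \<bar>nth_largest L (\<eta> x) 1 - nth_largest L (\<eta> x) 2\<bar> \<le> t} \<le> C\<beta> * t powr \<beta>)"


section \<open>Classifiers\<close>

definition err :: "('a \<times> nat) measure \<Rightarrow> ('a \<Rightarrow> nat) \<Rightarrow> real" where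
  "err P h = measure P {z \<in> space P. h (fst z) \<noteq> snd z}"

text \<open>A rule for breaking ties among labels picks one element of each nonempty set of labels.\<close>

definition tie_rule :: "nat \<Rightarrow> (nat set \<Rightarrow> nat) \<Rightarrow> bool" where
  "tie_rule L \<tau> \<longleftrightarrow> (\<forall>S. S \<subseteq> {1..L} \<and> S \<noteq> {} \<longrightarrow> \<tau> S \<in> S)"

definition argmax_label :: "(nat set \<Rightarrow> nat) \<Rightarrow> nat \<Rightarrow> (nat \<Rightarrow> real) \<Rightarrow> nat" where
  "argmax_label \<tau> L f = \<tau> {l. is_arg_max f (\<lambda>l. l \<in> {1..L}) l}"

definition bayes :: "(nat set \<Rightarrow> nat) \<Rightarrow> nat \<Rightarrow> ('a \<Rightarrow> nat \<Rightarrow> real) \<Rightarrow> 'a \<Rightarrow> nat" where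
  "bayes \<tau> L \<eta> x = argmax_label \<tau> L (\<eta> x)"

text \<open>For a sample \<open>xs 1, \<dots>, xs n\<close> and a set \<open>J\<close> of indices, \<open>\<kappa> J k xs x\<close> is a set of exactly
  \<open>k\<close> indices from \<open>J\<close> of points nearest to \<open>x\<close>. Equal distances may be resolved in any
  measurable way.\<close>

definition nn_rule ::
  "'a::euclidean_space set \<Rightarrow> nat \<Rightarrow> (nat set \<Rightarrow> nat \<Rightarrow> (nat \<Rightarrow> 'a) \<Rightarrow> 'a \<Rightarrow> nat set) \<Rightarrow> bool" where
  "nn_rule \<X> n \<kappa> \<longleftrightarrow>
     (\<forall>J k. J \<subseteq> {1..n} \<and> 1 \<le> k \<and> k \<le> card J \<longrightarrow>
        (\<forall>xs \<in> {1..n} \<rightarrow>\<^sub>E \<X>. \<forall>x\<in>\<X>.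
           \<kappa> J k xs x \<subseteq> J \<and> card (\<kappa> J k xs x) = k \<and>
           (\<forall>i \<in> \<kappa> J k xs x. \<forall>j \<in> J - \<kappa> J k xs x. dist x (xs i) \<le> dist x (xs j))) \<and>
        (\<forall>i. Measurable.pred
           ((\<Pi>\<^sub>M i\<in>{1..n}. restrict_space borel \<X>) \<Otimes>\<^sub>M restrict_space borel \<X>)
           (\<lambda>(xs, x). i \<in> \<kappa> J k xs x)))"

text \<open>From here on a labelled sample is a function \<open>zs\<close> on \<open>{1..n}\<close> with \<open>zs i = (X\<^sub>i, Y\<^sub>i)\<close>.\<close>

definition points :: "nat \<Rightarrow> (nat \<Rightarrow> 'a \<times> nat) \<Rightarrow> nat \<Rightarrow> 'a" where
  "points n zs = (\<lambda>i\<in>{1..n}. fst (zs i))"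

definition knn_estimate ::
  "(nat set \<Rightarrow> nat \<Rightarrow> (nat \<Rightarrow> 'a) \<Rightarrow> 'a \<Rightarrow> nat set) \<Rightarrow> nat \<Rightarrow> nat \<Rightarrow> (nat \<Rightarrow> 'a \<times> nat)
     \<Rightarrow> 'a \<Rightarrow> nat \<Rightarrow> real" where
  "knn_estimate \<kappa> n k zs x l =
     (\<Sum>i \<in> \<kappa> {1..n} k (points n zs) x. of_bool (snd (zs i) = l)) / real k"

definition knn_classifier ::
  "(nat set \<Rightarrow> nat) \<Rightarrow> (nat set \<Rightarrow> nat \<Rightarrow> (nat \<Rightarrow> 'a) \<Rightarrow> 'a \<Rightarrow> nat set) \<Rightarrow> nat \<Rightarrow> nat \<Rightarrow> nat
     \<Rightarrow> (nat \<Rightarrow> 'a \<times> nat) \<Rightarrow> 'a \<Rightarrow> nat" where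
  "knn_classifier \<tau> \<kappa> L n k zs x = argmax_label \<tau> L (knn_estimate \<kappa> n k zs x)"

text \<open>A subsample is given by the set \<open>J\<close> of its indices.\<close>

definition nearest_neighbor ::
  "(nat set \<Rightarrow> nat \<Rightarrow> (nat \<Rightarrow> 'a) \<Rightarrow> 'a \<Rightarrow> nat set) \<Rightarrow> nat \<Rightarrow> (nat \<Rightarrow> 'a \<times> nat) \<Rightarrow> nat set
     \<Rightarrow> 'a \<Rightarrow> 'a" where
  "nearest_neighbor \<nu> n zs J x = fst (zs (the_elem (\<nu> J 1 (points n zs) x)))"

definition denoised_1nn ::
  "(nat set \<Rightarrow> nat) \<Rightarrow> (nat set \<Rightarrow> nat \<Rightarrow> (nat \<Rightarrow> 'a) \<Rightarrow> 'a \<Rightarrow> nat set)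
     \<Rightarrow> (nat set \<Rightarrow> nat \<Rightarrow> (nat \<Rightarrow> 'a) \<Rightarrow> 'a \<Rightarrow> nat set) \<Rightarrow> nat \<Rightarrow> nat \<Rightarrow> nat
     \<Rightarrow> (nat \<Rightarrow> 'a \<times> nat) \<Rightarrow> nat set \<Rightarrow> 'a \<Rightarrow> nat" where
  "denoised_1nn \<tau> \<kappa> \<nu> L n k zs J x =
     knn_classifier \<tau> \<kappa> L n k zs (nearest_neighbor \<nu> n zs J x)"

definition subnn ::
  "(nat set \<Rightarrow> nat) \<Rightarrow> (nat set \<Rightarrow> nat) \<Rightarrow> (nat set \<Rightarrow> nat \<Rightarrow> (nat \<Rightarrow> 'a) \<Rightarrow> 'a \<Rightarrow> nat set)
     \<Rightarrow> (nat set \<Rightarrow> nat \<Rightarrow> (nat \<Rightarrow> 'a) \<Rightarrow> 'a \<Rightarrow> nat set) \<Rightarrow> nat \<Rightarrow> nat \<Rightarrow> nat \<Rightarrow> nat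
     \<Rightarrow> (nat \<Rightarrow> 'a \<times> nat) \<Rightarrow> (nat \<Rightarrow> nat set) \<Rightarrow> 'a \<Rightarrow> nat" where
  "subnn \<sigma> \<tau> \<kappa> \<nu> L n k I zs Js x =
     argmax_label \<sigma> L (\<lambda>l. real (card {i \<in> {1..I}. denoised_1nn \<tau> \<kappa> \<nu> L n k zs (Js i) x = l}))"

text \<open>Joint law of the sample and of the index sets of the \<open>I\<close> subsamples.\<close>

definition draw ::
  "('a \<times> nat) measure \<Rightarrow> nat \<Rightarrow> nat \<Rightarrow> nat
     \<Rightarrow> ((nat \<Rightarrow> 'a \<times> nat) \<times> (nat \<Rightarrow> nat set)) measure" where
  "draw P n m I = (\<Pi>\<^sub>M i\<in>{1..n}. P) \<Otimes>\<^sub>M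
     (\<Pi>\<^sub>M i\<in>{1..I}. uniform_count_measure {J. J \<subseteq> {1..n} \<and> card J = m})"

end

theory Submission
  imports Defs
begin

text \<open>At a sample point the \<open>k\<close>-nearest-neighbor estimate is close to \<open>\<eta>\<close>: its neighbors are near, by a
  covering argument with a finite net, and given the points the labels are independent, so that
  Hoeffding's inequality applies. A subsample is good if all of \<open>\<X>\<close> is close to it, which again follows from a
  net. A denoised 1-NN rule from a good subsample then predicts at every \<open>x\<close> a label whose probability is
  within some \<open>t\<close> of the maximum. With high probability fewer than \<open>I / L\<close> of the subsamples are bad, and
  then the majority label is predicted by a good one. A classifier with this property errs only where
  the margin is at most \<open>t\<close>, and by at most \<open>t\<close>, which gives the exponent \<open>\<beta> + 1\<close>. The VC dimension enters
  only through \<open>V \<ge> 1\<close>.\<close>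

section \<open>Labels and margins\<close>

text \<open>The obstacle is that the denoised rule queries the estimate at a random point which
  depends on the sample and on the subsample. The neighbors of that point depend on all the points,
  the query point included. The concentration bound therefore has to allow index sets that the
  points determine in an arbitrary measurable way, with only the labels left random. The number
  \<open>k\<close> is fixed before the draw: it is computed from \<open>L\<close>, \<open>n\<close>,
  \<delta>, \<alpha> and \<open>d\<close> alone. The failure probability is spent as \<delta> / 2 on
  too few sample points near some place, \<delta> / 2 on deviating labels, and \<delta> on too many
  bad subsamples; the total 2 * \<delta> is at most L * \<delta> because L \<ge> 2. Two regimes are
  trivial and are split off: for \<delta> > 1 / 2 the claimed probability is negative, and for ln (L
  * n / \<delta>) > n the claimed bound is at least 1. What remains is 1 \<le> ln (L * n / \<delta>)
  \<le> n, the range in which \<open>k\<close> can be chosen.\<close>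

text \<open>Sorting the labels by \<open>f\<close>, instead of sorting the values, keeps track of
  who attains them. The two labels obtained are thus distinct even when the two largest values
  coincide.\<close>

lemma ex_nth_largest:
  assumes "L \<ge> 2"
  obtains a b where "a \<in> {1..L}" "b \<in> {1..L}" "a \<noteq> b"
    "nth_largest L f 1 = f a" "nth_largest L f 2 = f b"
    "\<And>l. l \<in> {1..L} \<Longrightarrow> f l \<le> f a" "\<And>l. l \<in> {1..L} \<Longrightarrow> l \<noteq> a \<Longrightarrow> f l \<le> f b"
proof -
  define ys where "ys = rev (sort_key f [1..<Suc L])"
  have sort: "sort (map f [1..<Suc L]) = map f (sort_key f [1..<Suc L])"
    by (rule properties_for_sort) (simp_all del: upt_Suc)
  have len: "length ys = L" and dist: "distinct ys" and set: "set ys = {1..L}"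
    by (simp_all add: ys_def atLeastLessThanSuc_atLeastAtMost del: upt_Suc)
  have nth: "nth_largest L f i = f (ys ! (i - 1))" if "i \<in> {1..L}" for i
  proof -
    have "nth_largest L f i = map f ys ! (i - 1)"
      by (simp only: nth_largest_def sort ys_def rev_map)
    also have "\<dots> = f (ys ! (i - 1))" using that len by (intro nth_map) auto
    finally show ?thesis .
  qed
  have dec: "f (ys ! j) \<le> f (ys ! i)" if "i \<le> j" "j < L" for i j
  proof -
    have "sorted (rev (map f ys))"
      by (simp add: ys_def rev_map del: upt_Suc)
    then show ?thesis using sorted_rev_nth_mono[of "map f ys" i j] that len by simp
  qed
  have ix: "\<exists>j<L. l = ys ! j" if "l \<in> {1..L}" for l
    using that set len by (metis in_set_conv_nth)
  show ?thesis
  proof (rule that[of "ys ! 0" "ys ! 1"])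
    show "ys ! 0 \<in> {1..L}" "ys ! 1 \<in> {1..L}" using assms len set nth_mem[of _ ys] by auto
    show "ys ! 0 \<noteq> ys ! 1" using dist len assms by (simp add: nth_eq_iff_index_eq)
    show "nth_largest L f 1 = f (ys ! 0)" "nth_largest L f 2 = f (ys ! 1)"
      using nth[of 1] nth[of 2] assms by simp_all
    fix l assume "l \<in> {1..L}"
    then obtain j where j: "j < L" "l = ys ! j" using ix by blast
    show "f l \<le> f (ys ! 0)" using dec[of 0 j] j by simp
    assume "l \<noteq> ys ! 0"
    then have "j \<noteq> 0" using j by metis
    then show "f l \<le> f (ys ! 1)" using dec[of 1 j] j by simp
  qed
qed

text \<open>This replaces sorting by finitely many comparisons. The right side defines a measurable
  set when \<open>f\<close> depends measurably on a point, and its negation yields a label that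
  beats every other one by more than \<open>t\<close>.\<close>

lemma margin_le_iff:
  assumes "L \<ge> 2" "0 \<le> t"
  shows "\<bar>nth_largest L f 1 - nth_largest L f 2\<bar> \<le> t \<longleftrightarrow>
    (\<forall>a\<in>{1..L}. \<exists>b\<in>{1..L}. b \<noteq> a \<and> f a \<le> f b + t)"
proof -
  obtain a b where ab: "a \<in> {1..L}" "b \<in> {1..L}" "a \<noteq> b"
    "nth_largest L f 1 = f a" "nth_largest L f 2 = f b"
    and a: "\<And>l. l \<in> {1..L} \<Longrightarrow> f l \<le> f a"
    and b: "\<And>l. l \<in> {1..L} \<Longrightarrow> l \<noteq> a \<Longrightarrow> f l \<le> f b"
    by (rule ex_nth_largest[OF assms(1), where f = f]) (rule that)
  have gap: "\<bar>nth_largest L f 1 - nth_largest L f 2\<bar> = f a - f b"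
    using a[OF ab(2)] ab(4,5) by (simp only: abs_of_nonneg diff_ge_0_iff_ge)
  show ?thesis
  proof
    assume le: "\<bar>nth_largest L f 1 - nth_largest L f 2\<bar> \<le> t"
    show "\<forall>c\<in>{1..L}. \<exists>b\<in>{1..L}. b \<noteq> c \<and> f c \<le> f b + t"
    proof
      fix c assume c: "c \<in> {1..L}"
      show "\<exists>b\<in>{1..L}. b \<noteq> c \<and> f c \<le> f b + t"
      \<comment> \<open>The runner-up \<open>b\<close> is the witness for every label but itself;
        for \<open>c = b\<close> the best label \<open>a\<close> takes its place.\<close>
      proof (cases "c = b")
        case True
        then show ?thesis using ab(1,3) a[OF c] assms(2) by (intro bexI[of _ a]) auto
      next
        case False
        then show ?thesis using ab(2) a[OF c] le gap by (intro bexI[of _ b]) auto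
      qed
    qed
  next
    assume "\<forall>c\<in>{1..L}. \<exists>b\<in>{1..L}. b \<noteq> c \<and> f c \<le> f b + t"
    then obtain c where "c \<in> {1..L}" "c \<noteq> a" "f a \<le> f c + t" using ab(1) by blast
    then show "\<bar>nth_largest L f 1 - nth_largest L f 2\<bar> \<le> t" using b[of c] gap by simp
  qed
qed

lemma is_arg_max_label_iff:
  fixes f :: "nat \<Rightarrow> real"
  shows "is_arg_max f (\<lambda>l. l \<in> {1..L}) l \<longleftrightarrow> l \<in> {1..L} \<and> (\<forall>j\<in>{1..L}. f j \<le> f l)"
  unfolding is_arg_max_def by (metis not_less)

lemma argmax_label:
  assumes "tie_rule L \<tau>" "L \<ge> 1"
  shows "argmax_label \<tau> L f \<in> {1..L}"
    and "l \<in> {1..L} \<Longrightarrow> f l \<le> f (argmax_label \<tau> L f)"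
proof -
  let ?S = "{l. is_arg_max f (\<lambda>l. l \<in> {1..L}) l}"
  have "finite (f ` {1..L})" "f ` {1..L} \<noteq> {}" using assms(2) by auto
  then obtain a where a: "a \<in> {1..L}" "f a = Max (f ` {1..L})" by (metis Max_in imageE)
  then have "a \<in> ?S" unfolding is_arg_max_label_iff by simp
  then have "?S \<subseteq> {1..L} \<and> ?S \<noteq> {}" unfolding is_arg_max_label_iff by blast
  then have "argmax_label \<tau> L f \<in> ?S"
    using assms(1) unfolding tie_rule_def argmax_label_def by blast
  then show "argmax_label \<tau> L f \<in> {1..L}"
    and "l \<in> {1..L} \<Longrightarrow> f l \<le> f (argmax_label \<tau> L f)"
    unfolding is_arg_max_label_iff by blast+
qed

text \<open>The tie rule may be any function: the set of maximizers takes its values in the finite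
  set \<open>Pow {1..L}\<close>, and on a discrete space every function is measurable.\<close>

lemma measurable_argmax_label:
  fixes f :: "nat \<Rightarrow> 'b \<Rightarrow> real"
  assumes [measurable]: "\<And>l. l \<in> {1..L} \<Longrightarrow> f l \<in> borel_measurable M"
  shows "(\<lambda>\<omega>. argmax_label \<tau> L (\<lambda>l. f l \<omega>)) \<in> measurable M (count_space UNIV)"
proof -
  define S where "S \<omega> = {l. is_arg_max (\<lambda>l. f l \<omega>) (\<lambda>l. l \<in> {1..L}) l}" for \<omega>
  have S_iff: "l \<in> S \<omega> \<longleftrightarrow> l \<in> {1..L} \<and> (\<forall>j\<in>{1..L}. f j \<omega> \<le> f l \<omega>)" for l \<omega>
    unfolding S_def mem_Collect_eq is_arg_max_label_iff ..
  have "S \<in> measurable M (count_space (Pow {1..L}))"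
  proof (subst measurable_count_space_eq2, safe)
    fix A assume A: "A \<subseteq> {1..L}"
    have "S \<omega> = A \<longleftrightarrow> (\<forall>l\<in>{1..L}. (l \<in> A) = (\<forall>j\<in>{1..L}. f j \<omega> \<le> f l \<omega>))" for \<omega>
      using A S_iff[of _ \<omega>] by blast
    then have "S -` {A} \<inter> space M =
        {\<omega> \<in> space M. \<forall>l\<in>{1..L}. (l \<in> A) = (\<forall>j\<in>{1..L}. f j \<omega> \<le> f l \<omega>)}"
      by blast
    also have "\<dots> \<in> sets M" by measurable
    finally show "S -` {A} \<inter> space M \<in> sets M" .
  qed (simp_all only: S_iff finite_Pow_iff finite_atLeastAtMost)
  then have "(\<lambda>\<omega>. \<tau> (S \<omega>)) \<in> measurable M (count_space UNIV)"
    by (rule measurable_compose) simp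
  then show ?thesis by (simp add: argmax_label_def S_def)
qed

text \<open>The votes of the voters outside \<open>B\<close> cannot all be for labels other than the winner, since the
  winner collects at least a fraction \<open>1 / L\<close> of all votes.\<close>

lemma plurality_voter:
  assumes \<tau>: "tie_rule L \<tau>" and L: "L \<ge> 1" and fin: "finite J"
    and h: "\<And>i. i \<in> J \<Longrightarrow> h i \<in> {1..L}" and B: "L * card B < card J" "finite B"
  obtains i where "i \<in> J" "i \<notin> B" "h i = argmax_label \<tau> L (\<lambda>l. real (card {i \<in> J. h i = l}))"
proof -
  let ?a = "argmax_label \<tau> L (\<lambda>l. real (card {i \<in> J. h i = l}))"
  have "J = (\<Union>l\<in>{1..L}. {i \<in> J. h i = l})" using h by auto
  then have "card J \<le> (\<Sum>l\<in>{1..L}. card {i \<in> J. h i = l})"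
    using card_UN_le[of "{1..L}" "\<lambda>l. {i \<in> J. h i = l}"] by simp
  also have "\<dots> \<le> (\<Sum>l\<in>{1..L}. card {i \<in> J. h i = ?a})"
    using argmax_label(2)[OF \<tau> L, where f = "\<lambda>l. real (card {i \<in> J. h i = l})"]
    by (intro sum_mono) (simp only: of_nat_le_iff)
  also have "\<dots> = L * card {i \<in> J. h i = ?a}" by simp
  finally have "L * card B < L * card {i \<in> J. h i = ?a}" using B(1) by linarith
  then have "card B < card {i \<in> J. h i = ?a}" by (rule mult_less_cancel1[THEN iffD1, THEN conjunct2])
  then have "\<not> {i \<in> J. h i = ?a} \<subseteq> B" using card_mono[OF B(2)] by (meson not_le)
  then show ?thesis using that by blast
qed

section \<open>Metric facts\<close>

text \<open>Positive diameter provides two distinct points. Balls around them with radius half their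
  distance pick out both subsets of the singleton formed by one of them.\<close>

lemma vc_dim_balls_in_ge_1:
  fixes \<X> :: "'a::euclidean_space set"
  assumes "0 < diameter \<X>"
  shows "1 \<le> the_enat (vc_dim (balls_in \<X>))"
proof -
  have "\<exists>x\<in>\<X>. \<exists>y\<in>\<X>. x \<noteq> y"
  proof (rule ccontr)
    assume "\<not> ?thesis"
    then have "\<X> = {} \<or> (\<exists>x. \<X> = {x})" by blast
    then show False using assms by auto
  qed
  then obtain x y where xy: "x \<in> \<X>" "y \<in> \<X>" "x \<noteq> y" by blast
  have "\<X> \<inter> cball z (dist x y / 2) \<in> balls_in \<X>" if "z \<in> \<X>" for z
    using xy that by (auto simp: balls_in_def intro!: exI[of _ z] exI[of _ "dist x y / 2"])
  moreover have "\<X> \<inter> cball x (dist x y / 2) \<inter> {x} = {x}" "\<X> \<inter> cball y (dist x y / 2) \<inter> {x} = {}"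
    using xy by (auto simp: dist_commute)
  ultimately have "{x} \<in> (\<lambda>B. B \<inter> {x}) ` balls_in \<X>" "{} \<in> (\<lambda>B. B \<inter> {x}) ` balls_in \<X>"
    using xy by (metis (no_types, lifting) rev_image_eqI)+
  then have "shatters (balls_in \<X>) {x}"
    unfolding shatters_def by (auto simp: Pow_insert)
  then have "enat (card {x}) \<le> vc_dim (balls_in \<X>)"
    unfolding vc_dim_def by (intro SUP_upper) simp
  then show ?thesis
    using vc_dim_balls_in_finite[of \<X>] by (cases "vc_dim (balls_in \<X>)") auto
qed

text \<open>If a selected index were farther away than \<open>r\<close>, no point within
  \<open>r\<close> could have been left out. Together with that index this would make more than
  \<open>k\<close> selected indices.\<close>

lemma nn_rule_dist_le:
  assumes \<kappa>: "nn_rule \<X> n \<kappa>" and J: "J \<subseteq> {1..n}" "1 \<le> k"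
    and xs: "xs \<in> {1..n} \<rightarrow>\<^sub>E \<X>" and x: "x \<in> \<X>"
    and many: "k \<le> card {i \<in> J. dist x (xs i) \<le> r}" and i: "i \<in> \<kappa> J k xs x"
  shows "dist x (xs i) \<le> r"
proof (rule ccontr)
  assume far: "\<not> dist x (xs i) \<le> r"
  have fin: "finite J" using J(1) finite_subset by blast
  have "k \<le> card J" using many card_mono[OF fin, of "{i \<in> J. dist x (xs i) \<le> r}"] by auto
  then have K: "\<kappa> J k xs x \<subseteq> J" "card (\<kappa> J k xs x) = k"
    and near: "\<And>i j. i \<in> \<kappa> J k xs x \<Longrightarrow> j \<in> J - \<kappa> J k xs x \<Longrightarrow> dist x (xs i) \<le> dist x (xs j)"
    using \<kappa> J xs x unfolding nn_rule_def by blast+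
  have "{i \<in> J. dist x (xs i) \<le> r} \<subseteq> \<kappa> J k xs x - {i}"
    using near[OF i] far by force
  then have "card {i \<in> J. dist x (xs i) \<le> r} \<le> card (\<kappa> J k xs x - {i})"
    using K(1) fin by (intro card_mono) (auto intro: finite_subset)
  also have "\<dots> < k" using K i J(2) by (metis card_Diff1_less card_gt_0_iff less_le_trans zero_less_one)
  finally show False using many by simp
qed

section \<open>Labelled samples\<close>

locale classification = prob_space P
  for P :: "('a::euclidean_space \<times> nat) measure" +
  fixes \<X> :: "'a set" and L :: nat and \<eta> :: "'a \<Rightarrow> nat \<Rightarrow> real"
  assumes sets_P: "sets P = sets (xy_space \<X> L)"
    and regression: "regression_function \<X> L P \<eta>"
begin

abbreviation "MX \<equiv> restrict_space borel \<X>"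
abbreviation "PX \<equiv> x_marginal \<X> P"

lemma space_P: "space P = \<X> \<times> {1..L}"
  using sets_eq_imp_space_eq[OF sets_P]
  by (simp add: xy_space_def space_pair_measure space_restrict_space)

lemma measurable_P: "measurable P N = measurable (MX \<Otimes>\<^sub>M count_space {1..L}) N"
  using measurable_cong_sets[OF sets_P refl, of N] by (simp add: xy_space_def)

lemma measurable_fst_P [measurable]: "fst \<in> measurable P MX"
  unfolding measurable_P by measurable

lemma measurable_snd_P [measurable]: "snd \<in> measurable P (count_space UNIV)"
  unfolding measurable_P
  by (rule measurable_compose[OF measurable_snd]) simp

lemma sets_PX [measurable_cong, simp]: "sets PX = sets MX"
  by (simp add: x_marginal_def)

lemma space_PX [simp]: "space PX = \<X>"
  by (simp add: x_marginal_def space_restrict_space)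

lemma measurable_fst_PX [measurable]: "fst \<in> measurable P PX"
  using measurable_fst_P by (simp cong: measurable_cong_sets)

lemma prob_space_PX: "prob_space PX"
  unfolding x_marginal_def by (rule prob_space_distr) measurable

lemma \<eta>_range: "x \<in> \<X> \<Longrightarrow> l \<in> {1..L} \<Longrightarrow> 0 \<le> \<eta> x l \<and> \<eta> x l \<le> 1"
  using regression unfolding regression_function_def by blast

lemma measurable_\<eta>: "l \<in> {1..L} \<Longrightarrow> (\<lambda>x. \<eta> x l) \<in> borel_measurable MX"
  using regression unfolding regression_function_def
  by (metis measurable_cong_sets sets_PX)

lemma integrable_\<eta>:
  assumes "l \<in> {1..L}"
  shows "integrable PX (\<lambda>x. \<eta> x l)"
proof -
  interpret PX: prob_space PX by (rule prob_space_PX)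
  have [measurable]: "(\<lambda>x. \<eta> x l) \<in> borel_measurable MX" using measurable_\<eta>[OF assms] .
  show ?thesis
    by (rule PX.integrable_const_bound[where B = 1]) (use \<eta>_range assms in auto)
qed

section \<open>The law of a label given the point\<close>

lemma measure_label:
  assumes "A \<in> sets MX" "l \<in> {1..L}"
  shows "measure P {z \<in> space P. fst z \<in> A \<and> snd z = l} = (\<integral>x. indicator A x * \<eta> x l \<partial>PX)"
proof -
  have "A \<subseteq> \<X>" using sets.sets_into_space[OF assms(1)] by (simp add: space_restrict_space)
  then have "{z \<in> space P. fst z \<in> A \<and> snd z = l} = A \<times> {l}" using assms(2) by (auto simp: space_P)
  then show ?thesis
    using regression assms unfolding regression_function_def set_lebesgue_integral_def by simp
qed

text \<open>Projected to the points, the parts of \<open>P\<close> with label \<open>l\<close> and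
  with another label have densities \<open>\<eta> x l\<close> and \<open>1 - \<eta> x l\<close>. The
  second claim is obtained by subtracting from the mass of \<open>A\<close>.\<close>

lemma emeasure_label:
  assumes A: "A \<in> sets MX" and l: "l \<in> {1..L}"
  shows "emeasure P {z \<in> space P. fst z \<in> A \<and> snd z = l} =
      (\<integral>\<^sup>+x. ennreal (\<eta> x l) * indicator A x \<partial>PX)" (is ?pos)
    and "emeasure P {z \<in> space P. fst z \<in> A \<and> snd z \<noteq> l} =
      (\<integral>\<^sup>+x. ennreal (1 - \<eta> x l) * indicator A x \<partial>PX)" (is ?neg)
proof -
  interpret PX: prob_space PX by (rule prob_space_PX)
  have [measurable]: "A \<in> sets MX" by fact
  have int: "integrable PX (\<lambda>x. indicator A x * \<eta> x l)"
    by (rule integrable_real_mult_indicator[OF _ integrable_\<eta>[OF l], simplified mult.commute]) simp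
  have int1: "integrable PX (indicator A :: 'a \<Rightarrow> real)"
    by (rule integrable_real_indicator) (simp_all add: less_top[symmetric])
  have ae: "AE x in PX. 0 \<le> indicator A x * \<eta> x l" "AE x in PX. 0 \<le> indicator A x * (1 - \<eta> x l)"
    using \<eta>_range l by auto
  show ?pos
    unfolding emeasure_eq_measure measure_label[OF A l]
    by (subst nn_integral_eq_integral[OF int ae(1), symmetric])
       (auto intro!: nn_integral_cong simp: indicator_def)
  have "measure P {z \<in> space P. fst z \<in> A \<and> snd z \<noteq> l} =
      measure P ({z \<in> space P. fst z \<in> A} - {z \<in> space P. fst z \<in> A \<and> snd z = l})"
    by (intro arg_cong[of _ _ "measure P"]) auto
  also have "\<dots> = measure P {z \<in> space P. fst z \<in> A} - (\<integral>x. indicator A x * \<eta> x l \<partial>PX)"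
    unfolding measure_label[OF A l, symmetric] by (rule finite_measure_Diff) (measurable, auto)
  also have "{z \<in> space P. fst z \<in> A} = fst -` A \<inter> space P" by auto
  also have "measure P (fst -` A \<inter> space P) = measure PX A"
    unfolding x_marginal_def using A by (simp add: measure_distr)
  also have "measure PX A = (\<integral>x. indicator A x \<partial>PX)"
    using sets.sets_into_space[OF A] by (simp add: space_restrict_space Int_absorb2)
  also have "(\<integral>x. indicator A x \<partial>PX) - (\<integral>x. indicator A x * \<eta> x l \<partial>PX)
      = (\<integral>x. indicator A x * (1 - \<eta> x l) \<partial>PX)"
    by (subst Bochner_Integration.integral_diff[OF int1 int, symmetric]) (simp add: algebra_simps)
  finally have *: "measure P {z \<in> space P. fst z \<in> A \<and> snd z \<noteq> l}
    = (\<integral>x. indicator A x * (1 - \<eta> x l) \<partial>PX)" .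
  have int2: "integrable PX (\<lambda>x. indicator A x * (1 - \<eta> x l))"
    using Bochner_Integration.integrable_diff[OF int1 int] by (simp add: algebra_simps)
  show ?neg
    unfolding emeasure_eq_measure *
    by (subst nn_integral_eq_integral[OF int2 ae(2), symmetric])
       (auto intro!: nn_integral_cong simp: indicator_def)
qed

text \<open>A disintegration of \<open>P\<close> over the points, for the split of the labels into
  \<open>l\<close> and the rest only. This suffices since deviations are bounded for one label at a
  time.\<close>

lemma nn_integral_label:
  assumes [measurable]: "f \<in> borel_measurable MX" "g \<in> borel_measurable MX" and l: "l \<in> {1..L}"
  shows "(\<integral>\<^sup>+z. (if snd z = l then f (fst z) else g (fst z)) \<partial>P) =
    (\<integral>\<^sup>+x. ennreal (\<eta> x l) * f x + ennreal (1 - \<eta> x l) * g x \<partial>PX)"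
proof -
  note [measurable] = measurable_\<eta>[OF l]
  \<comment> \<open>If the projection of \<open>P\<close> restricted to \<open>S\<close> agrees on
    all sets with the measure of density \<open>q\<close>, integrals of functions of the point agree
    as well. It is used for both halves of the split.\<close>
  have *: "(\<integral>\<^sup>+z. indicator S z * h (fst z) \<partial>P) = (\<integral>\<^sup>+x. q x * h x \<partial>PX)"
    if S[measurable]: "S \<in> sets P" and q[measurable]: "q \<in> borel_measurable MX"
      and h[measurable]: "h \<in> borel_measurable MX"
      and eq: "\<And>A. A \<in> sets MX \<Longrightarrow> emeasure P {z \<in> space P. fst z \<in> A \<and> z \<in> S} =
        (\<integral>\<^sup>+x. q x * indicator A x \<partial>PX)" for S q h
  proof -
    have "distr (density P (indicator S)) PX fst = density PX q"
    proof (rule measure_eqI)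
      fix A assume "A \<in> sets (distr (density P (indicator S)) PX fst)"
      then have [measurable]: "A \<in> sets MX" by simp
      have "emeasure (distr (density P (indicator S)) PX fst) A =
          (\<integral>\<^sup>+z. indicator S z * indicator (fst -` A \<inter> space P) z \<partial>P)"
        by (subst emeasure_distr) (simp_all add: emeasure_density)
      also have "\<dots> = (\<integral>\<^sup>+z. indicator {z \<in> space P. fst z \<in> A \<and> z \<in> S} z \<partial>P)"
        by (intro nn_integral_cong) (auto simp: indicator_def)
      also have "\<dots> = emeasure P {z \<in> space P. fst z \<in> A \<and> z \<in> S}"
        by (rule nn_integral_indicator) measurable
      finally show "emeasure (distr (density P (indicator S)) PX fst) A = emeasure (density PX q) A"
        by (simp add: eq emeasure_density)
    qed simp
    then have "(\<integral>\<^sup>+x. h x \<partial>distr (density P (indicator S)) PX fst) = (\<integral>\<^sup>+x. h x \<partial>density PX q)"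
      by simp
    then show ?thesis by (simp add: nn_integral_distr nn_integral_density)
  qed
  have "(\<integral>\<^sup>+z. (if snd z = l then f (fst z) else g (fst z)) \<partial>P) =
      (\<integral>\<^sup>+z. indicator {z \<in> space P. snd z = l} z * f (fst z)
        + indicator {z \<in> space P. snd z \<noteq> l} z * g (fst z) \<partial>P)"
    by (intro nn_integral_cong) (auto simp: indicator_def)
  also have "\<dots> = (\<integral>\<^sup>+z. indicator {z \<in> space P. snd z = l} z * f (fst z) \<partial>P)
      + (\<integral>\<^sup>+z. indicator {z \<in> space P. snd z \<noteq> l} z * g (fst z) \<partial>P)"
    by (rule nn_integral_add) measurable
  also have "(\<integral>\<^sup>+z. indicator {z \<in> space P. snd z = l} z * f (fst z) \<partial>P) =
      (\<integral>\<^sup>+x. ennreal (\<eta> x l) * f x \<partial>PX)"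
    by (rule *) (measurable, simp add: emeasure_label(1)[OF _ l, symmetric] conj_commute
        cong: conj_cong)
  also have "(\<integral>\<^sup>+z. indicator {z \<in> space P. snd z \<noteq> l} z * g (fst z) \<partial>P) =
      (\<integral>\<^sup>+x. ennreal (1 - \<eta> x l) * g x \<partial>PX)"
    by (rule *) (measurable, simp add: emeasure_label(2)[OF _ l, symmetric] conj_commute
        cong: conj_cong)
  finally show ?thesis
    by (simp add: nn_integral_add)
qed

text \<open>Conditionally on the points, the factors are independent and have mean at most 1.\<close>

lemma nn_integral_conditional_prod_le:
  assumes "finite I" and l: "l \<in> {1..L}"
    and "\<And>i. i \<in> I \<Longrightarrow> f i \<in> borel_measurable (\<Pi>\<^sub>M i\<in>I. MX)"
    and "\<And>i. i \<in> I \<Longrightarrow> g i \<in> borel_measurable (\<Pi>\<^sub>M i\<in>I. MX)"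
    and "\<And>i xs. i \<in> I \<Longrightarrow> xs \<in> I \<rightarrow>\<^sub>E \<X> \<Longrightarrow>
      ennreal (\<eta> (xs i) l) * f i xs + ennreal (1 - \<eta> (xs i) l) * g i xs \<le> 1"
  shows "(\<integral>\<^sup>+zs. (\<Prod>i\<in>I. if snd (zs i) = l then f i (\<lambda>i\<in>I. fst (zs i)) else g i (\<lambda>i\<in>I. fst (zs i)))
    \<partial>(\<Pi>\<^sub>M i\<in>I. P)) \<le> (1::ennreal)"
  using assms(1,3-)
proof (induction I arbitrary: f g rule: finite_induct)
  case empty
  interpret product_prob_space "\<lambda>_. P" "{}" by standard
  show ?case by (simp add: emeasure_space_1)
next
  case (insert j I)
  interpret PX: prob_space PX by (rule prob_space_PX)
  interpret product_sigma_finite "\<lambda>_. P" by standard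
  interpret PI: prob_space "\<Pi>\<^sub>M i\<in>I. P" by (rule prob_space_PiM) unfold_locales
  interpret pair_sigma_finite PX "\<Pi>\<^sub>M i\<in>I. P" by standard
  note [measurable] = measurable_\<eta>[OF l]
  have [measurable]: "f i \<in> borel_measurable (\<Pi>\<^sub>M i\<in>insert j I. MX)"
    "g i \<in> borel_measurable (\<Pi>\<^sub>M i\<in>insert j I. MX)" if "i \<in> insert j I" for i
    using insert.prems(1,2) that by auto
  define p where "p K zs = (\<lambda>i\<in>K. fst (zs i))" for K and zs :: "'b \<Rightarrow> 'a \<times> nat"
  have p[measurable]: "p K \<in> measurable (\<Pi>\<^sub>M i\<in>K. P) (\<Pi>\<^sub>M i\<in>K. MX)" for K
    unfolding p_def by measurable
  have p_upd: "p (insert j I) (zs(j := z)) = (p I zs)(j := fst z)" for zs z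
    by (auto simp: p_def fun_eq_iff)
  have p_space: "(p I zs)(j := x) \<in> insert j I \<rightarrow>\<^sub>E \<X>" if "zs \<in> space (\<Pi>\<^sub>M i\<in>I. P)" "x \<in> \<X>" for zs x
    using that by (auto simp: p_def space_PiM space_P PiE_iff extensional_def mem_Times_iff)
  have upd[measurable]: "(\<lambda>(x, zs). (p I zs)(j := x)) \<in>
      measurable (PX \<Otimes>\<^sub>M (\<Pi>\<^sub>M i\<in>I. P)) (\<Pi>\<^sub>M i\<in>insert j I. MX)"
    by measurable
  \<comment> \<open>The product over the old indices, with the new point \<open>x\<close> inserted
    as coordinate \<open>j\<close>. It depends on the new observation through its point but not
    through its label.\<close>
  define F where "F x zs = (\<Prod>i\<in>I. if snd (zs i) = l then f i ((p I zs)(j := x)) else g i ((p I zs)(j := x)))"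
    for x zs
  have F[measurable]: "(\<lambda>(x, zs). F x zs) \<in> borel_measurable (PX \<Otimes>\<^sub>M (\<Pi>\<^sub>M i\<in>I. P))"
    unfolding F_def by measurable
  have "(\<integral>\<^sup>+zs. (\<Prod>i\<in>insert j I. if snd (zs i) = l then f i (p (insert j I) zs) else g i (p (insert j I) zs))
      \<partial>(\<Pi>\<^sub>M i\<in>insert j I. P)) =
    (\<integral>\<^sup>+zs. \<integral>\<^sup>+z. (\<Prod>i\<in>insert j I. if snd ((zs(j := z)) i) = l then f i (p (insert j I) (zs(j := z)))
      else g i (p (insert j I) (zs(j := z)))) \<partial>P \<partial>(\<Pi>\<^sub>M i\<in>I. P))"
    using insert.hyps by (intro product_nn_integral_insert) measurable
  also have "\<dots> = (\<integral>\<^sup>+zs. \<integral>\<^sup>+z. (if snd z = l then f j ((p I zs)(j := fst z)) * F (fst z) zs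
      else g j ((p I zs)(j := fst z)) * F (fst z) zs) \<partial>P \<partial>(\<Pi>\<^sub>M i\<in>I. P))"
  proof (intro nn_integral_cong)
    fix zs z
    have "(\<Prod>i\<in>I. if snd ((zs(j := z)) i) = l then f i ((p I zs)(j := fst z))
      else g i ((p I zs)(j := fst z))) = F (fst z) zs"
      unfolding F_def using insert.hyps by (intro prod.cong) auto
    then show "(\<Prod>i\<in>insert j I. if snd ((zs(j := z)) i) = l then f i (p (insert j I) (zs(j := z)))
        else g i (p (insert j I) (zs(j := z)))) =
      (if snd z = l then f j ((p I zs)(j := fst z)) * F (fst z) zs
      else g j ((p I zs)(j := fst z)) * F (fst z) zs)"
      using insert.hyps by (simp only: p_upd prod.insert) simp
  qed
  also have "\<dots> = (\<integral>\<^sup>+zs. \<integral>\<^sup>+x. ennreal (\<eta> x l) * (f j ((p I zs)(j := x)) * F x zs)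
      + ennreal (1 - \<eta> x l) * (g j ((p I zs)(j := x)) * F x zs) \<partial>PX \<partial>(\<Pi>\<^sub>M i\<in>I. P))"
  proof (intro nn_integral_cong nn_integral_label l)
    fix zs assume [measurable]: "zs \<in> space (\<Pi>\<^sub>M i\<in>I. P)"
    have [measurable]: "(\<lambda>x. (p I zs)(j := x)) \<in> measurable MX (\<Pi>\<^sub>M i\<in>insert j I. MX)"
      using measurable_Pair1[OF upd, of zs] by simp
    show "(\<lambda>x. f j ((p I zs)(j := x)) * F x zs) \<in> borel_measurable MX"
      "(\<lambda>x. g j ((p I zs)(j := x)) * F x zs) \<in> borel_measurable MX"
      by measurable
  qed
  \<comment> \<open>With all points held fixed, averaging over label \<open>j\<close> leaves a
    factor of at most 1.\<close>
  also have "\<dots> \<le> (\<integral>\<^sup>+zs. \<integral>\<^sup>+x. F x zs \<partial>PX \<partial>(\<Pi>\<^sub>M i\<in>I. P))"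
  proof (intro nn_integral_mono)
    fix zs x assume "zs \<in> space (\<Pi>\<^sub>M i\<in>I. P)" "x \<in> space PX"
    then have "ennreal (\<eta> x l) * f j ((p I zs)(j := x)) + ennreal (1 - \<eta> x l) * g j ((p I zs)(j := x)) \<le> 1"
      using insert.prems(3)[OF insertI1 p_space, of zs x] by (simp only: fun_upd_same space_PX)
    then have "(ennreal (\<eta> x l) * f j ((p I zs)(j := x)) + ennreal (1 - \<eta> x l) * g j ((p I zs)(j := x)))
        * F x zs \<le> 1 * F x zs"
      by (intro mult_right_mono) auto
    then show "ennreal (\<eta> x l) * (f j ((p I zs)(j := x)) * F x zs)
      + ennreal (1 - \<eta> x l) * (g j ((p I zs)(j := x)) * F x zs) \<le> F x zs"
      by (simp add: algebra_simps)
  qed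
  also have "\<dots> = (\<integral>\<^sup>+x. \<integral>\<^sup>+zs. F x zs \<partial>(\<Pi>\<^sub>M i\<in>I. P) \<partial>PX)"
    by (rule Fubini') measurable
  \<comment> \<open>For a fixed new point \<open>x\<close> the remaining factors are functions of
    the other points, with \<open>x\<close> frozen in. This is why the induction runs over arbitrary
    \<open>f\<close> and \<open>g\<close>.\<close>
  also have "\<dots> \<le> (\<integral>\<^sup>+x. 1 \<partial>PX)"
  proof (intro nn_integral_mono)
    fix x assume x: "x \<in> space PX"
    have upd: "(\<lambda>ys. ys(j := x)) \<in> measurable (\<Pi>\<^sub>M i\<in>I. MX) (\<Pi>\<^sub>M i\<in>insert j I. MX)"
      using x by (intro measurable_fun_upd[where J = I]) (auto simp: space_restrict_space)
    show "(\<integral>\<^sup>+zs. F x zs \<partial>(\<Pi>\<^sub>M i\<in>I. P)) \<le> 1"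
      unfolding F_def p_def
    proof (rule insert.IH)
      fix i assume i: "i \<in> I"
      show "(\<lambda>ys. f i (ys(j := x))) \<in> borel_measurable (\<Pi>\<^sub>M i\<in>I. MX)"
        "(\<lambda>ys. g i (ys(j := x))) \<in> borel_measurable (\<Pi>\<^sub>M i\<in>I. MX)"
        using i by (auto intro!: measurable_compose[OF upd])
      fix ys assume "ys \<in> I \<rightarrow>\<^sub>E \<X>"
      then have ys: "ys(j := x) \<in> insert j I \<rightarrow>\<^sub>E \<X>" using x by (auto simp: PiE_iff extensional_def)
      have ij: "i \<noteq> j" using i insert.hyps by auto
      show "ennreal (\<eta> (ys i) l) * f i (ys(j := x)) + ennreal (1 - \<eta> (ys i) l) * g i (ys(j := x)) \<le> 1"
        using insert.prems(3)[OF insertI2[OF i] ys] by (simp only: fun_upd_other[OF ij])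
    qed
  qed
  also have "\<dots> = 1" using PX.emeasure_space_1 by simp
  finally show ?case by (simp only: p_def)
qed

end

section \<open>Concentration of the labels given the points\<close>

text \<open>Hoeffding's lemma for a centered Bernoulli variable. Negative \<open>c\<close> reduces
  to positive \<open>c\<close> by exchanging success and failure, that is, \<open>p\<close> and
  \<open>1 - p\<close>.\<close>

lemma bernoulli_mgf_le:
  fixes p c :: real
  assumes p: "0 \<le> p" "p \<le> 1"
  shows "p * exp (c * (1 - p)) + (1 - p) * exp (- (c * p)) \<le> exp (c\<^sup>2 / 8)"
proof -
  have *: "q * exp (a * (1 - q)) + (1 - q) * exp (- (a * q)) \<le> exp (a\<^sup>2 / 8)"
    if q: "0 \<le> q" "q \<le> 1" and a: "0 \<le> a" for a q :: real
  proof -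
    have pos: "0 < 1 + q * (exp a - 1)" using q a by (intro add_pos_nonneg mult_nonneg_nonneg) auto
    have "q * exp (a * (1 - q)) + (1 - q) * exp (- (a * q)) = exp (- a * q) * (1 + q * (exp a - 1))"
      by (simp add: algebra_simps flip: exp_add)
    also have "\<dots> = exp (- a * q + ln (1 + q * (exp a - 1)))"
      using pos by (simp only: exp_add exp_ln)
    also have "\<dots> \<le> exp (a\<^sup>2 / 8)"
      using Hoeffdings_lemma_aux[OF a q(1)] by simp
    finally show ?thesis .
  qed
  show ?thesis
    using *[of p c] *[of "1 - p" "- c"] p by (cases "0 \<le> c") (auto simp: algebra_simps)
qed

context classification
begin

lemma prob_space_sample: "prob_space (\<Pi>\<^sub>M i\<in>I. P)"
  by (rule prob_space_PiM) unfold_locales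

text \<open>A Chernoff bound. Dividing each selected factor by exp (c^2 / 8) brings its conditional
  mean down to at most 1. Since exactly \<open>k\<close> indices are selected whatever the points
  are, the total normalization is a constant and Markov's inequality finishes.\<close>

lemma conditional_mgf_bound:
  assumes I: "finite I" and l: "l \<in> {1..L}"
    and w[measurable]: "\<And>i. i \<in> I \<Longrightarrow> Measurable.pred (\<Pi>\<^sub>M i\<in>I. MX) (w i)"
    and k: "\<And>xs. xs \<in> I \<rightarrow>\<^sub>E \<X> \<Longrightarrow> card {i \<in> I. w i xs} = k"
  shows "measure (\<Pi>\<^sub>M i\<in>I. P) {zs \<in> space (\<Pi>\<^sub>M i\<in>I. P). a \<le> c * (\<Sum>i\<in>I.
      of_bool (w i (\<lambda>i\<in>I. fst (zs i))) * (of_bool (snd (zs i) = l) - \<eta> (fst (zs i)) l))}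
    \<le> exp (real k * c\<^sup>2 / 8 - a)"
proof -
  interpret PI: prob_space "\<Pi>\<^sub>M i\<in>I. P" by (rule prob_space_sample)
  note [measurable] = measurable_\<eta>[OF l]
  define p where "p zs = (\<lambda>i\<in>I. fst (zs i))" for zs :: "'b \<Rightarrow> 'a \<times> nat"
  have p_space: "p zs \<in> I \<rightarrow>\<^sub>E \<X>" if "zs \<in> space (\<Pi>\<^sub>M i\<in>I. P)" for zs
    using that by (auto simp: p_def space_PiM space_P PiE_iff extensional_def mem_Times_iff)
  \<comment> \<open>Here \<open>b\<close> is the value of the label indicator, 1 or 0; indices that
    are not selected contribute the neutral factor 1.\<close>
  define \<phi> where "\<phi> b i xs = ennreal (if w i xs then exp (c * (b - \<eta> (xs i) l) - c\<^sup>2 / 8) else 1)"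
    for b i xs
  define S where "S zs = (\<Sum>i\<in>I. of_bool (w i (p zs)) * (of_bool (snd (zs i) = l) - \<eta> (fst (zs i)) l))"
    for zs
  have prod: "(\<Prod>i\<in>I. if snd (zs i) = l then \<phi> 1 i (p zs) else \<phi> 0 i (p zs)) =
      ennreal (exp (c * S zs - real k * c\<^sup>2 / 8))" if zs: "zs \<in> space (\<Pi>\<^sub>M i\<in>I. P)" for zs
  proof -
    have "(\<Prod>i\<in>I. if snd (zs i) = l then \<phi> 1 i (p zs) else \<phi> 0 i (p zs)) =
      (\<Prod>i\<in>I. ennreal (exp (c * (of_bool (w i (p zs)) * (of_bool (snd (zs i) = l) - \<eta> (fst (zs i)) l))
        - of_bool (w i (p zs)) * (c\<^sup>2 / 8))))"
      by (intro prod.cong) (auto simp: \<phi>_def p_def)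
    also have "\<dots> = ennreal (exp (c * S zs - (\<Sum>i\<in>I. of_bool (w i (p zs))) * (c\<^sup>2 / 8)))"
      using I by (simp only: prod_ennreal exp_ge_zero exp_sum[symmetric] sum_subtractf S_def
          sum_distrib_left sum_distrib_right)
    also have "(\<Sum>i\<in>I. of_bool (w i (p zs))) = real k"
      using k[OF p_space[OF zs]] I by (simp add: Int_def)
    finally show ?thesis by (simp add: ac_simps)
  qed
  have \<phi>_meas[measurable]: "\<phi> b i \<in> borel_measurable (\<Pi>\<^sub>M i\<in>I. MX)" if "i \<in> I" for i b
    using that unfolding \<phi>_def by measurable
  have "(\<integral>\<^sup>+zs. (\<Prod>i\<in>I. if snd (zs i) = l then \<phi> 1 i (p zs) else \<phi> 0 i (p zs)) \<partial>(\<Pi>\<^sub>M i\<in>I. P)) \<le> 1"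
    unfolding p_def
  proof (rule nn_integral_conditional_prod_le[OF I l])
    fix i xs assume i: "i \<in> I" "xs \<in> I \<rightarrow>\<^sub>E \<X>"
    then have \<eta>: "0 \<le> \<eta> (xs i) l" "\<eta> (xs i) l \<le> 1" using \<eta>_range[OF _ l, of "xs i"] by auto
    have "\<eta> (xs i) l * exp (c * (1 - \<eta> (xs i) l) - c\<^sup>2 / 8)
        + (1 - \<eta> (xs i) l) * exp (c * (0 - \<eta> (xs i) l) - c\<^sup>2 / 8) =
      (\<eta> (xs i) l * exp (c * (1 - \<eta> (xs i) l)) + (1 - \<eta> (xs i) l) * exp (- (c * \<eta> (xs i) l)))
        / exp (c\<^sup>2 / 8)"
      by (simp add: exp_diff add_divide_distrib)
    also have "\<dots> \<le> 1" using bernoulli_mgf_le[OF \<eta>, of c] by simp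
    finally show "ennreal (\<eta> (xs i) l) * \<phi> 1 i xs + ennreal (1 - \<eta> (xs i) l) * \<phi> 0 i xs \<le> 1"
      using \<eta> by (simp add: \<phi>_def flip: ennreal_mult ennreal_plus)
  qed measurable
  then have le: "(\<integral>\<^sup>+zs. ennreal (exp (c * S zs - real k * c\<^sup>2 / 8)) \<partial>(\<Pi>\<^sub>M i\<in>I. P)) \<le> 1"
    by (simp add: prod cong: nn_integral_cong)
  have [measurable]: "S \<in> borel_measurable (\<Pi>\<^sub>M i\<in>I. P)" unfolding S_def p_def by measurable
  have "emeasure (\<Pi>\<^sub>M i\<in>I. P) {zs \<in> space (\<Pi>\<^sub>M i\<in>I. P). a \<le> c * S zs} \<le>
    emeasure (\<Pi>\<^sub>M i\<in>I. P) {zs \<in> space (\<Pi>\<^sub>M i\<in>I. P).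
      1 \<le> ennreal (exp (real k * c\<^sup>2 / 8 - a)) * ennreal (exp (c * S zs - real k * c\<^sup>2 / 8))}"
    by (intro emeasure_mono) (auto simp flip: ennreal_mult exp_add)
  also have "\<dots> \<le> ennreal (exp (real k * c\<^sup>2 / 8 - a)) *
      (\<integral>\<^sup>+zs. ennreal (exp (c * S zs - real k * c\<^sup>2 / 8)) * indicator (space (\<Pi>\<^sub>M i\<in>I. P)) zs \<partial>(\<Pi>\<^sub>M i\<in>I. P))"
    by (rule nn_integral_Markov_inequality) measurable
  also have "\<dots> \<le> ennreal (exp (real k * c\<^sup>2 / 8 - a)) * 1"
    using le by (intro mult_left_mono) (simp_all cong: nn_integral_cong)
  finally show ?thesis
    unfolding S_def p_def PI.emeasure_eq_measure by simp
qed

lemma conditional_Hoeffding: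
  fixes \<epsilon> :: real
  assumes I: "finite I" and l: "l \<in> {1..L}"
    and w[measurable]: "\<And>i. i \<in> I \<Longrightarrow> Measurable.pred (\<Pi>\<^sub>M i\<in>I. MX) (w i)"
    and k: "\<And>xs. xs \<in> I \<rightarrow>\<^sub>E \<X> \<Longrightarrow> card {i \<in> I. w i xs} = k"
    and \<epsilon>: "0 < \<epsilon>"
  defines "S \<equiv> \<lambda>zs. \<Sum>i\<in>I. of_bool (w i (\<lambda>i\<in>I. fst (zs i))) * (of_bool (snd (zs i) = l) - \<eta> (fst (zs i)) l)"
  shows "{zs \<in> space (\<Pi>\<^sub>M i\<in>I. P). real k * \<epsilon> \<le> \<bar>S zs\<bar>} \<in> sets (\<Pi>\<^sub>M i\<in>I. P)"
    and "measure (\<Pi>\<^sub>M i\<in>I. P) {zs \<in> space (\<Pi>\<^sub>M i\<in>I. P). real k * \<epsilon> \<le> \<bar>S zs\<bar>}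
      \<le> 2 * exp (- (2 * real k * \<epsilon>\<^sup>2))"
proof -
  interpret PI: prob_space "\<Pi>\<^sub>M i\<in>I. P" by (rule prob_space_sample)
  note [measurable] = measurable_\<eta>[OF l]
  have [measurable]: "S \<in> borel_measurable (\<Pi>\<^sub>M i\<in>I. P)" unfolding S_def by measurable
  show "{zs \<in> space (\<Pi>\<^sub>M i\<in>I. P). real k * \<epsilon> \<le> \<bar>S zs\<bar>} \<in> sets (\<Pi>\<^sub>M i\<in>I. P)" by measurable
  \<comment> \<open>The choice c = 4 * \<epsilon> minimizes k * c^2 / 8 - c * k * \<epsilon>, with
    minimum - 2 * k * \<epsilon>^2; the opposite sign serves the lower tail.\<close>
  have one: "PI.prob {zs \<in> space (\<Pi>\<^sub>M i\<in>I. P). 4 * real k * \<epsilon>\<^sup>2 \<le> c * S zs} \<le> exp (- (2 * real k * \<epsilon>\<^sup>2))"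
    if "c\<^sup>2 = 16 * \<epsilon>\<^sup>2" for c
  proof -
    have "real k * c\<^sup>2 / 8 - 4 * real k * \<epsilon>\<^sup>2 = - (2 * real k * \<epsilon>\<^sup>2)" using that by simp
    then show ?thesis
      using conditional_mgf_bound[OF I l w k, of "4 * real k * \<epsilon>\<^sup>2" c] by (simp only: S_def)
  qed
  have "{zs \<in> space (\<Pi>\<^sub>M i\<in>I. P). real k * \<epsilon> \<le> \<bar>S zs\<bar>} \<subseteq>
    {zs \<in> space (\<Pi>\<^sub>M i\<in>I. P). 4 * real k * \<epsilon>\<^sup>2 \<le> (4 * \<epsilon>) * S zs} \<union>
    {zs \<in> space (\<Pi>\<^sub>M i\<in>I. P). 4 * real k * \<epsilon>\<^sup>2 \<le> (- 4 * \<epsilon>) * S zs}"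
  proof safe
    fix zs assume "real k * \<epsilon> \<le> \<bar>S zs\<bar>" "\<not> 4 * real k * \<epsilon>\<^sup>2 \<le> (- 4 * \<epsilon>) * S zs"
    then have "4 * \<epsilon> * (real k * \<epsilon>) \<le> 4 * \<epsilon> * \<bar>S zs\<bar>" "4 * \<epsilon> * (real k * \<epsilon>) > 4 * \<epsilon> * (- S zs)"
      using \<epsilon> by (auto simp: power2_eq_square algebra_simps)
    then show "4 * real k * \<epsilon>\<^sup>2 \<le> (4 * \<epsilon>) * S zs"
      by (cases "S zs \<ge> 0") (auto simp: power2_eq_square algebra_simps)
  qed
  then have "PI.prob {zs \<in> space (\<Pi>\<^sub>M i\<in>I. P). real k * \<epsilon> \<le> \<bar>S zs\<bar>} \<le>
    PI.prob ({zs \<in> space (\<Pi>\<^sub>M i\<in>I. P). 4 * real k * \<epsilon>\<^sup>2 \<le> (4 * \<epsilon>) * S zs} \<union>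
    {zs \<in> space (\<Pi>\<^sub>M i\<in>I. P). 4 * real k * \<epsilon>\<^sup>2 \<le> (- 4 * \<epsilon>) * S zs})"
    by (intro PI.finite_measure_mono) measurable
  also have "\<dots> \<le> PI.prob {zs \<in> space (\<Pi>\<^sub>M i\<in>I. P). 4 * real k * \<epsilon>\<^sup>2 \<le> (4 * \<epsilon>) * S zs} +
    PI.prob {zs \<in> space (\<Pi>\<^sub>M i\<in>I. P). 4 * real k * \<epsilon>\<^sup>2 \<le> (- 4 * \<epsilon>) * S zs}"
    by (rule measure_Un_le) measurable
  also have "\<dots> \<le> 2 * exp (- (2 * real k * \<epsilon>\<^sup>2))"
    using one[of "4 * \<epsilon>"] one[of "- 4 * \<epsilon>"] by (simp add: power_mult_distrib)
  finally show "PI.prob {zs \<in> space (\<Pi>\<^sub>M i\<in>I. P). real k * \<epsilon> \<le> \<bar>S zs\<bar>} \<le> 2 * exp (- (2 * real k * \<epsilon>\<^sup>2))" .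
qed

section \<open>Balls around a net\<close>

text \<open>A separated set of largest cardinality is a net, since a point far from all of it could
  be added. Balls of half the radius around separated points are disjoint and each has mass at least
  Cd * (\<rho> / 2)^d, which bounds their number.\<close>

lemma ex_net:
  assumes mass: "mass_condition \<X> P d Cd" and \<rho>: "0 < \<rho>" "\<rho> \<le> diameter \<X>"
  obtains C where "finite C" "C \<subseteq> \<X>" "real (card C) * (Cd * (\<rho> / 2) ^ d) \<le> 1"
    "\<And>x. x \<in> \<X> \<Longrightarrow> \<exists>c\<in>C. dist x c \<le> \<rho>"
proof -
  interpret PX: prob_space PX by (rule prob_space_PX)
  \<comment> \<open>The strict inequality is what makes the closed balls of radius
    \<open>\<rho> / 2\<close> disjoint.\<close>
  define sep where "sep C \<longleftrightarrow> finite C \<and> C \<subseteq> \<X> \<and> (\<forall>x\<in>C. \<forall>y\<in>C. x \<noteq> y \<longrightarrow> \<rho> < dist x y)" for C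
  have Cd: "0 < Cd" using mass by (simp add: mass_condition_def)
  have bound: "real (card C) * (Cd * (\<rho> / 2) ^ d) \<le> 1" if C: "sep C" for C
  proof -
    let ?B = "\<lambda>c. \<X> \<inter> cball c (\<rho> / 2)"
    have "?B c \<in> sets MX" for c by (auto simp: sets_restrict_space)
    moreover have "disjoint_family_on ?B C"
      unfolding disjoint_family_on_def
    proof safe
      fix x y z assume xy: "x \<in> C" "y \<in> C" "x \<noteq> y"
        and z: "z \<in> cball x (\<rho> / 2)" "z \<in> cball y (\<rho> / 2)"
      have "dist x y \<le> dist x z + dist y z" by (rule dist_triangle2)
      then have "dist x y \<le> \<rho>" using z by simp
      moreover have "\<rho> < dist x y" using C xy by (simp add: sep_def)
      ultimately show "z \<in> {}" by simp
    qed
    ultimately have "PX.prob (\<Union>c\<in>C. ?B c) = (\<Sum>c\<in>C. PX.prob (?B c))"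
      using C by (intro PX.finite_measure_finite_Union) (auto simp: sep_def)
    moreover have "(\<Sum>c\<in>C. PX.prob (?B c)) \<ge> (\<Sum>c\<in>C. Cd * (\<rho> / 2) ^ d)"
      using C mass \<rho> by (intro sum_mono) (auto simp: sep_def mass_condition_def)
    ultimately show ?thesis using PX.prob_le_1[of "\<Union>c\<in>C. ?B c"] by simp
  qed
  have "card C < nat \<lceil>1 / (Cd * (\<rho> / 2) ^ d)\<rceil> + 1" if "sep C" for C
  proof -
    have "real (card C) \<le> 1 / (Cd * (\<rho> / 2) ^ d)"
      using bound[OF that] Cd \<rho> by (simp add: pos_le_divide_eq)
    then show ?thesis by linarith
  qed
  moreover have "sep {}" by (simp add: sep_def)
  ultimately obtain C where C: "sep C" and max: "\<And>C'. sep C' \<Longrightarrow> card C' \<le> card C"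
    using ex_has_greatest_nat[of sep "{}" card "nat \<lceil>1 / (Cd * (\<rho> / 2) ^ d)\<rceil> + 1"] by auto
  show ?thesis
  proof (rule that[of C])
    fix x assume x: "x \<in> \<X>"
    show "\<exists>c\<in>C. dist x c \<le> \<rho>"
    proof (rule ccontr)
      assume "\<not> ?thesis"
      then have far: "\<rho> < dist x c" if "c \<in> C" for c using that by (auto simp: not_le)
      then have "x \<notin> C" using \<rho> by fastforce
      moreover have "sep (insert x C)"
        using C x far by (auto simp: sep_def dist_commute)
      ultimately show False using max[of "insert x C"] C by (simp add: sep_def)
    qed
  qed (use C bound in \<open>auto simp: sep_def\<close>)
qed

text \<open>A lower-tail Chernoff bound with base 1 / 2: the expectation of (1 / 2)^N, where N
  counts the hits in the ball, is at most exp (- card J * q / 2). Fewer than \<open>k\<close> hits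
  force (1 / 2)^N \<ge> exp (- k), because 2 \<le> exp 1.\<close>

lemma prob_few_points_le:
  assumes I: "finite I" "J \<subseteq> I" and c: "c \<in> \<X>" and q: "q \<le> measure PX (\<X> \<inter> cball c \<rho>)"
  shows "{zs \<in> space (\<Pi>\<^sub>M i\<in>I. P). card {i \<in> J. dist c (fst (zs i)) \<le> \<rho>} < k} \<in> sets (\<Pi>\<^sub>M i\<in>I. P)"
    and "measure (\<Pi>\<^sub>M i\<in>I. P) {zs \<in> space (\<Pi>\<^sub>M i\<in>I. P). card {i \<in> J. dist c (fst (zs i)) \<le> \<rho>} < k}
      \<le> exp (real k - real (card J) * q / 2)"
proof -
  interpret PI: prob_space "\<Pi>\<^sub>M i\<in>I. P" by (rule prob_space_sample)
  interpret product_sigma_finite "\<lambda>_. P" by standard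
  have J: "finite J" using I finite_subset by blast
  let ?B = "\<lambda>z. dist c (fst z) \<le> \<rho>"
  have [measurable]: "Measurable.pred P ?B"
  proof -
    have "Measurable.pred MX (\<lambda>x. dist c x \<le> \<rho>)"
      by (rule measurable_restrict_space1) measurable
    then show ?thesis by measurable
  qed
  define N where "N zs = (\<Sum>i\<in>J. of_bool (?B (zs i)) :: real)" for zs :: "'b \<Rightarrow> 'a \<times> nat"
  have N: "N zs = real (card {i \<in> J. ?B (zs i)})" for zs
    using J by (simp add: N_def Int_def)
  have [measurable]: "(\<lambda>zs. zs i) \<in> measurable (\<Pi>\<^sub>M i\<in>I. P) P" if "i \<in> J" for i
    using that I by (intro measurable_component_singleton) auto
  have [measurable]: "N \<in> borel_measurable (\<Pi>\<^sub>M i\<in>I. P)"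
    unfolding N_def by measurable
  have eq: "{zs \<in> space (\<Pi>\<^sub>M i\<in>I. P). card {i \<in> J. ?B (zs i)} < k} =
      {zs \<in> space (\<Pi>\<^sub>M i\<in>I. P). N zs < real k}"
    by (simp add: N)
  show "{zs \<in> space (\<Pi>\<^sub>M i\<in>I. P). card {i \<in> J. ?B (zs i)} < k} \<in> sets (\<Pi>\<^sub>M i\<in>I. P)"
    unfolding eq by measurable
  define \<phi> where "\<phi> i z = ennreal (if i \<in> J \<and> ?B z then 1 / 2 else 1)" for i and z :: "'a \<times> nat"
  have [measurable]: "\<phi> i \<in> borel_measurable P" for i unfolding \<phi>_def by measurable
  have prod: "(\<Prod>i\<in>I. \<phi> i (zs i)) = ennreal ((1 / 2) powr N zs)" for zs
  proof -
    have "(\<Prod>i\<in>I. \<phi> i (zs i)) = (\<Prod>i\<in>J. \<phi> i (zs i))"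
      using I by (intro prod.mono_neutral_right) (auto simp: \<phi>_def)
    also have "\<dots> = (\<Prod>i\<in>J. ennreal ((1 / 2) powr of_bool (?B (zs i))))"
      by (intro prod.cong) (auto simp: \<phi>_def)
    also have "\<dots> = ennreal ((1 / 2) powr N zs)"
      using J unfolding N_def by (subst prod_ennreal, simp, subst powr_sum) simp_all
    finally show ?thesis .
  qed
  have expect: "(\<integral>\<^sup>+z. \<phi> i z \<partial>P) \<le> ennreal (if i \<in> J then exp (- q / 2) else 1)" for i
  proof (cases "i \<in> J")
    case True
    have int: "integrable P (\<lambda>z. 1 - indicator {z \<in> space P. ?B z} z / 2 :: real)"
      by (rule integrable_const_bound[where B = 1], simp add: indicator_def, measurable)
    have "(\<integral>\<^sup>+z. \<phi> i z \<partial>P) = (\<integral>\<^sup>+z. ennreal (1 - indicator {z \<in> space P. ?B z} z / 2) \<partial>P)"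
      using True by (intro nn_integral_cong) (auto simp: \<phi>_def indicator_def)
    also have "\<dots> = ennreal (\<integral>z. 1 - indicator {z \<in> space P. ?B z} z / 2 \<partial>P)"
      by (intro nn_integral_eq_integral int) (auto simp: indicator_def)
    also have "(\<integral>z. 1 - indicator {z \<in> space P. ?B z} z / 2 \<partial>P) = 1 - prob {z \<in> space P. ?B z} / 2"
      by (subst Bochner_Integration.integral_diff)
        (auto intro!: integrable_real_indicator simp: less_top[symmetric] prob_space)
    also have "prob {z \<in> space P. ?B z} = measure PX (\<X> \<inter> cball c \<rho>)"
    proof -
      have "{z \<in> space P. ?B z} = fst -` (\<X> \<inter> cball c \<rho>) \<inter> space P" by (auto simp: space_P)
      moreover have "\<X> \<inter> cball c \<rho> \<in> sets MX" by (auto simp: sets_restrict_space)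
      ultimately show ?thesis by (simp add: x_marginal_def measure_distr)
    qed
    also have "ennreal (1 - measure PX (\<X> \<inter> cball c \<rho>) / 2) \<le> ennreal (exp (- q / 2))"
      using q exp_ge_add_one_self[of "- q / 2"] by (intro ennreal_leI) simp
    finally show ?thesis using True by simp
  next
    case False
    then show ?thesis by (simp add: \<phi>_def emeasure_space_1)
  qed
  have "(\<integral>\<^sup>+zs. ennreal ((1 / 2) powr N zs) \<partial>(\<Pi>\<^sub>M i\<in>I. P)) = (\<Prod>i\<in>I. \<integral>\<^sup>+z. \<phi> i z \<partial>P)"
    unfolding prod[symmetric] using I by (intro product_nn_integral_prod) auto
  also have "\<dots> \<le> (\<Prod>i\<in>I. ennreal (if i \<in> J then exp (- q / 2) else 1))"
    using expect by (intro prod_mono_ennreal) auto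
  also have "\<dots> = (\<Prod>i\<in>J. ennreal (exp (- q / 2)))"
    using I by (subst prod.mono_neutral_right[of I J]) auto
  also have "\<dots> = ennreal (exp (- (real (card J) * q / 2)))"
    by (simp add: ennreal_power flip: exp_of_nat_mult)
  finally have le: "(\<integral>\<^sup>+zs. ennreal ((1 / 2) powr N zs) \<partial>(\<Pi>\<^sub>M i\<in>I. P)) \<le> \<dots>" .
  have "emeasure (\<Pi>\<^sub>M i\<in>I. P) {zs \<in> space (\<Pi>\<^sub>M i\<in>I. P). N zs < real k} \<le>
    emeasure (\<Pi>\<^sub>M i\<in>I. P) {zs \<in> space (\<Pi>\<^sub>M i\<in>I. P). 1 \<le> ennreal (exp (real k)) * ennreal ((1 / 2) powr N zs)}"
  proof (intro emeasure_mono subsetI)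
    fix zs assume "zs \<in> {zs \<in> space (\<Pi>\<^sub>M i\<in>I. P). N zs < real k}"
    then have zs: "zs \<in> space (\<Pi>\<^sub>M i\<in>I. P)" "N zs < real k" by auto
    have "(2::real) powr N zs \<le> 2 powr real k" using zs by simp
    also have "\<dots> \<le> exp 1 powr real k" using exp_ge_add_one_self[of 1] by (intro powr_mono2) auto
    also have "\<dots> = exp (real k)" by (simp add: powr_def)
    finally have "1 \<le> exp (real k) * (1 / 2) powr N zs"
      by (simp add: powr_divide pos_le_divide_eq)
    then show "zs \<in> {zs \<in> space (\<Pi>\<^sub>M i\<in>I. P). 1 \<le> ennreal (exp (real k)) * ennreal ((1 / 2) powr N zs)}"
      using zs by (simp flip: ennreal_mult)
  qed measurable
  also have "\<dots> \<le> ennreal (exp (real k)) *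
      (\<integral>\<^sup>+zs. ennreal ((1 / 2) powr N zs) * indicator (space (\<Pi>\<^sub>M i\<in>I. P)) zs \<partial>(\<Pi>\<^sub>M i\<in>I. P))"
    by (rule nn_integral_Markov_inequality) measurable
  also have "\<dots> \<le> ennreal (exp (real k)) * ennreal (exp (- (real (card J) * q / 2)))"
    using le by (intro mult_left_mono) (simp_all cong: nn_integral_cong)
  finally show "PI.prob {zs \<in> space (\<Pi>\<^sub>M i\<in>I. P). card {i \<in> J. ?B (zs i)} < k}
      \<le> exp (real k - real (card J) * q / 2)"
    unfolding eq PI.emeasure_eq_measure by (simp flip: ennreal_mult exp_add)
qed

text \<open>A net point within \<rho> of \<open>x\<close> has its \<rho>-ball inside the ball of
  radius 2 * \<rho> around \<open>x\<close>. So a union bound over the net controls all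
  \<open>x\<close> at once, and the exceptional set does not depend on \<open>x\<close>.\<close>

lemma uniform_cover:
  assumes mass: "mass_condition \<X> P d Cd" and I: "finite I" "J \<subseteq> I" and k: "k \<le> card J"
    and \<rho>: "0 < \<rho>"
  obtains E where "E \<in> sets (\<Pi>\<^sub>M i\<in>I. P)"
    "measure (\<Pi>\<^sub>M i\<in>I. P) E \<le> 2 ^ d / (Cd * \<rho> ^ d) * exp (real k - real (card J) * (Cd * \<rho> ^ d) / 2)"
    "\<And>zs x. zs \<in> space (\<Pi>\<^sub>M i\<in>I. P) - E \<Longrightarrow> x \<in> \<X> \<Longrightarrow> k \<le> card {i \<in> J. dist x (fst (zs i)) \<le> 2 * \<rho>}"
proof (cases "\<rho> \<le> diameter \<X>")
  \<comment> \<open>The mass condition is silent about radii beyond the diameter, but there every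
    ball contains the whole sample and the empty exceptional set works.\<close>
  case False
  have Cd: "0 < Cd" using mass by (simp add: mass_condition_def)
  show ?thesis
  proof (rule that[of "{}"])
    fix zs x assume zs: "zs \<in> space (\<Pi>\<^sub>M i\<in>I. P) - {}" and x: "x \<in> \<X>"
    have "dist x (fst (zs i)) \<le> 2 * \<rho>" if "i \<in> J" for i
    proof -
      have "zs i \<in> space P" using that I zs by (auto simp: space_PiM)
      then have "dist x (fst (zs i)) \<le> diameter \<X>"
        using mass x by (intro diameter_bounded_bound) (auto simp: mass_condition_def space_P)
      then show ?thesis using False \<rho> by simp
    qed
    then have "{i \<in> J. dist x (fst (zs i)) \<le> 2 * \<rho>} = J" by blast
    then show "k \<le> card {i \<in> J. dist x (fst (zs i)) \<le> 2 * \<rho>}" using k by simp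
  qed (use Cd \<rho> in auto)
next
  case True
  interpret PI: prob_space "\<Pi>\<^sub>M i\<in>I. P" by (rule prob_space_sample)
  have Cd: "0 < Cd" using mass by (simp add: mass_condition_def)
  obtain C where C: "finite C" "C \<subseteq> \<X>" "real (card C) * (Cd * (\<rho> / 2) ^ d) \<le> 1"
    and net: "\<And>x. x \<in> \<X> \<Longrightarrow> \<exists>c\<in>C. dist x c \<le> \<rho>"
    using ex_net[OF mass \<rho> True] by blast
  define E where "E c = {zs \<in> space (\<Pi>\<^sub>M i\<in>I. P). card {i \<in> J. dist c (fst (zs i)) \<le> \<rho>} < k}" for c
  have E: "E c \<in> sets (\<Pi>\<^sub>M i\<in>I. P)" "PI.prob (E c) \<le> exp (real k - real (card J) * (Cd * \<rho> ^ d) / 2)"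
    if "c \<in> C" for c
    using prob_few_points_le[OF I, of c "Cd * \<rho> ^ d" \<rho> k] that C mass \<rho> True
    by (auto simp: E_def mass_condition_def)
  have J: "finite J" using I finite_subset by blast
  show ?thesis
  proof (rule that[of "\<Union>c\<in>C. E c"])
    show "(\<Union>c\<in>C. E c) \<in> sets (\<Pi>\<^sub>M i\<in>I. P)" using E C by auto
    have "PI.prob (\<Union>c\<in>C. E c) \<le> (\<Sum>c\<in>C. PI.prob (E c))"
      using E C by (intro PI.finite_measure_subadditive_finite) auto
    also have "\<dots> \<le> (\<Sum>c\<in>C. exp (real k - real (card J) * (Cd * \<rho> ^ d) / 2))"
      using E by (intro sum_mono) auto
    also have "\<dots> = real (card C) * exp (real k - real (card J) * (Cd * \<rho> ^ d) / 2)" by simp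
    also have "\<dots> \<le> 2 ^ d / (Cd * \<rho> ^ d) * exp (real k - real (card J) * (Cd * \<rho> ^ d) / 2)"
      using C(3) Cd \<rho> by (intro mult_right_mono) (simp_all add: power_divide field_simps)
    finally show "PI.prob (\<Union>c\<in>C. E c) \<le> \<dots>" .
    fix zs x assume zs: "zs \<in> space (\<Pi>\<^sub>M i\<in>I. P) - (\<Union>c\<in>C. E c)" and x: "x \<in> \<X>"
    obtain c where c: "c \<in> C" "dist x c \<le> \<rho>" using net[OF x] by blast
    have "k \<le> card {i \<in> J. dist c (fst (zs i)) \<le> \<rho>}"
      using zs c(1) by (auto simp: E_def not_less)
    also have "\<dots> \<le> card {i \<in> J. dist x (fst (zs i)) \<le> 2 * \<rho>}"
    proof (intro card_mono)
      show "{i \<in> J. dist c (fst (zs i)) \<le> \<rho>} \<subseteq> {i \<in> J. dist x (fst (zs i)) \<le> 2 * \<rho>}"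
      proof safe
        fix i assume "dist c (fst (zs i)) \<le> \<rho>"
        then show "dist x (fst (zs i)) \<le> 2 * \<rho>"
          using c(2) dist_triangle[of x "fst (zs i)" c] by simp
      qed
    qed (use J in auto)
    finally show "k \<le> card {i \<in> J. dist x (fst (zs i)) \<le> 2 * \<rho>}" .
  qed
qed


section \<open>Regret of a classifier\<close>

text \<open>The probability of a correct prediction is split by the predicted label. On each of the
  finitely many pieces the label is constant and the defining property of the regression function
  applies.\<close>

lemma err_eq:
  assumes h[measurable]: "h \<in> measurable MX (count_space UNIV)" and range: "\<And>x. x \<in> \<X> \<Longrightarrow> h x \<in> {1..L}"
  shows "integrable PX (\<lambda>x. \<eta> x (h x))" and "err P h = 1 - (\<integral>x. \<eta> x (h x) \<partial>PX)"
proof -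
  interpret PX: prob_space PX by (rule prob_space_PX)
  define A where "A l = {x \<in> space MX. h x = l}" for l
  have A[measurable]: "A l \<in> sets MX" for l unfolding A_def by measurable
  have int: "integrable PX (\<lambda>x. indicator (A l) x * \<eta> x l)" if "l \<in> {1..L}" for l
    by (rule integrable_real_mult_indicator[OF _ integrable_\<eta>[OF that], simplified mult.commute]) simp
  have eq: "(\<Sum>l\<in>{1..L}. indicator (A l) x * \<eta> x l) = \<eta> x (h x)" if "x \<in> space PX" for x
  proof -
    have "(\<Sum>l\<in>{1..L}. indicator (A l) x * \<eta> x l) = (\<Sum>l\<in>{1..L}. if l = h x then \<eta> x l else 0)"
      using that by (intro sum.cong) (auto simp: A_def indicator_def space_restrict_space)
    then show ?thesis using range[of x] that by simp
  qed
  have "integrable PX (\<lambda>x. \<Sum>l\<in>{1..L}. indicator (A l) x * \<eta> x l)"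
    using int by (intro Bochner_Integration.integrable_sum) auto
  moreover have "integrable PX (\<lambda>x. \<Sum>l\<in>{1..L}. indicator (A l) x * \<eta> x l) \<longleftrightarrow>
      integrable PX (\<lambda>x. \<eta> x (h x))"
    by (intro Bochner_Integration.integrable_cong refl eq)
  ultimately show "integrable PX (\<lambda>x. \<eta> x (h x))" by (rule iffD1[rotated])
  let ?S = "\<lambda>l. {z \<in> space P. fst z \<in> A l \<and> snd z = l}"
  have S: "?S l \<in> sets P" for l by measurable
  have "{z \<in> space P. h (fst z) \<noteq> snd z} = space P - (\<Union>l\<in>{1..L}. ?S l)"
    by (auto simp: space_P A_def space_restrict_space)
  then have "err P h = 1 - prob (\<Union>l\<in>{1..L}. ?S l)"
    unfolding err_def using S by (simp add: prob_compl)
  also have "prob (\<Union>l\<in>{1..L}. ?S l) = (\<Sum>l\<in>{1..L}. prob (?S l))"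
    using S by (intro finite_measure_finite_Union) (auto simp: disjoint_family_on_def)
  also have "\<dots> = (\<Sum>l\<in>{1..L}. \<integral>x. indicator (A l) x * \<eta> x l \<partial>PX)"
    using measure_label[OF A] by (intro sum.cong) auto
  also have "\<dots> = (\<integral>x. (\<Sum>l\<in>{1..L}. indicator (A l) x * \<eta> x l) \<partial>PX)"
    using int by (intro Bochner_Integration.integral_sum[symmetric]) auto
  also have "\<dots> = (\<integral>x. \<eta> x (h x) \<partial>PX)"
    by (intro Bochner_Integration.integral_cong refl eq)
  finally show "err P h = 1 - (\<integral>x. \<eta> x (h x) \<partial>PX)" .
qed

lemma regret_le:
  assumes L: "L \<ge> 2" and margin: "margin_condition \<X> L P \<eta> \<beta> C\<beta>" and \<rho>: "tie_rule L \<rho>"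
    and h: "h \<in> measurable MX (count_space UNIV)" "\<And>x. x \<in> \<X> \<Longrightarrow> h x \<in> {1..L}"
    and t: "0 < t"
    and near: "\<And>x l. x \<in> \<X> \<Longrightarrow> l \<in> {1..L} \<Longrightarrow> \<eta> x l \<le> \<eta> x (h x) + t"
  shows "err P h - err P (bayes \<rho> L \<eta>) \<le> C\<beta> * t powr (\<beta> + 1)"
proof -
  interpret PX: prob_space PX by (rule prob_space_PX)
  have b: "bayes \<rho> L \<eta> \<in> measurable MX (count_space UNIV)"
    unfolding bayes_def[abs_def] by (intro measurable_argmax_label measurable_\<eta>)
  have b_range: "bayes \<rho> L \<eta> x \<in> {1..L}" and b_max: "\<And>l. l \<in> {1..L} \<Longrightarrow> \<eta> x l \<le> \<eta> x (bayes \<rho> L \<eta> x)" for x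
    using argmax_label[OF \<rho>, where f = "\<eta> x"] L unfolding bayes_def by auto
  define G where "G = {x \<in> \<X>. \<bar>nth_largest L (\<eta> x) 1 - nth_largest L (\<eta> x) 2\<bar> \<le> t}"
  \<comment> \<open>In this form the set is visibly measurable, and a point outside it comes with a
    clear winner among the labels.\<close>
  have G: "G = {x \<in> space MX. \<forall>a\<in>{1..L}. \<exists>b\<in>{1..L}. b \<noteq> a \<and> \<eta> x a \<le> \<eta> x b + t}"
    using margin_le_iff[OF L, of t] t by (simp add: G_def space_restrict_space)
  have [measurable]: "(\<lambda>x. \<eta> x l) \<in> borel_measurable MX" if "l \<in> {1..L}" for l
    using measurable_\<eta> that .
  have Gs: "G \<in> sets MX" unfolding G by measurable
  have "err P h - err P (bayes \<rho> L \<eta>) = (\<integral>x. \<eta> x (bayes \<rho> L \<eta> x) \<partial>PX) - (\<integral>x. \<eta> x (h x) \<partial>PX)"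
    using err_eq(2)[OF h] err_eq(2)[OF b b_range] by simp
  also have "\<dots> = (\<integral>x. \<eta> x (bayes \<rho> L \<eta> x) - \<eta> x (h x) \<partial>PX)"
    by (rule Bochner_Integration.integral_diff[symmetric, OF err_eq(1)[OF b b_range] err_eq(1)[OF h]])
  also have "\<dots> \<le> (\<integral>x. t * indicator G x \<partial>PX)"
  proof (rule integral_mono)
    show "integrable PX (\<lambda>x. \<eta> x (bayes \<rho> L \<eta> x) - \<eta> x (h x))"
      by (rule Bochner_Integration.integrable_diff[OF err_eq(1)[OF b b_range] err_eq(1)[OF h]])
    show "integrable PX (\<lambda>x. t * indicator G x :: real)"
      using Gs by (intro integrable_mult_right integrable_real_indicator) (simp_all add: less_top[symmetric])
    fix x assume x: "x \<in> space PX"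
    show "\<eta> x (bayes \<rho> L \<eta> x) - \<eta> x (h x) \<le> t * indicator G x"
    proof (cases "x \<in> G")
      case True
      then show ?thesis using near[of x "bayes \<rho> L \<eta> x"] b_range[of x] x by simp
    next
      case False
      \<comment> \<open>Outside \<open>G\<close> some label \<open>a\<close> exceeds all others by
        more than \<open>t\<close>. A prediction within \<open>t\<close> of the maximum must be
        \<open>a\<close>, and so must the Bayes prediction, so the regret vanishes there.\<close>
      then have "\<not> (\<forall>a\<in>{1..L}. \<exists>b\<in>{1..L}. b \<noteq> a \<and> \<eta> x a \<le> \<eta> x b + t)"
        using x by (simp add: G space_restrict_space)
      then obtain a where a: "a \<in> {1..L}" "\<And>b. b \<in> {1..L} \<Longrightarrow> b \<noteq> a \<Longrightarrow> \<eta> x b + t < \<eta> x a"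
        by (meson not_le)
      have "h x = a" using a(2)[OF h(2)[of x]] near[of x a] a(1) x by fastforce
      moreover have "bayes \<rho> L \<eta> x = a" using a(2)[OF b_range[of x]] b_max[OF a(1), of x] t by fastforce
      ultimately show ?thesis using False by simp
    qed
  qed
  also have "\<dots> = t * PX.prob G"
    using sets.sets_into_space[OF Gs] by (simp add: space_restrict_space Int_absorb2)
  also have "\<dots> \<le> t * (C\<beta> * t powr \<beta>)"
    using margin t by (intro mult_left_mono) (auto simp: margin_condition_def G_def)
  also have "\<dots> = C\<beta> * t powr (\<beta> + 1)"
    using t by (simp add: powr_add)
  finally show ?thesis .
qed

section \<open>Measurability of the subsampled classifier\<close>

lemma points_in: "zs \<in> space (\<Pi>\<^sub>M i\<in>{1..n}. P) \<Longrightarrow> points n zs \<in> {1..n} \<rightarrow>\<^sub>E \<X>"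
  by (auto simp: points_def space_PiM space_P PiE_iff extensional_def mem_Times_iff)

lemma point_in: "zs \<in> space (\<Pi>\<^sub>M i\<in>I. P) \<Longrightarrow> i \<in> I \<Longrightarrow> fst (zs i) \<in> \<X>"
  by (auto simp: space_PiM space_P PiE_iff mem_Times_iff)

lemma measurable_points [measurable]:
  "points n \<in> measurable (\<Pi>\<^sub>M i\<in>{1..n}. P) (\<Pi>\<^sub>M i\<in>{1..n}. MX)"
  unfolding points_def by measurable

lemma measurable_nn:
  assumes "nn_rule \<X> n \<kappa>" "J \<subseteq> {1..n}" "1 \<le> k" "k \<le> card J"
    and "f \<in> measurable M (\<Pi>\<^sub>M i\<in>{1..n}. MX)" "g \<in> measurable M MX"
  shows "Measurable.pred M (\<lambda>\<omega>. i \<in> \<kappa> J k (f \<omega>) (g \<omega>))"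
proof -
  have "Measurable.pred ((\<Pi>\<^sub>M i\<in>{1..n}. MX) \<Otimes>\<^sub>M MX) (\<lambda>(xs, x). i \<in> \<kappa> J k xs x)"
    using assms(1-4) unfolding nn_rule_def by blast
  from measurable_compose[OF measurable_Pair[OF assms(5,6)] this] show ?thesis by simp
qed

lemma measurable_knn_classifier:
  assumes \<kappa>: "nn_rule \<X> n \<kappa>" and k: "k \<in> {1..n}"
    and f[measurable]: "f \<in> measurable M (\<Pi>\<^sub>M i\<in>{1..n}. P)" and g[measurable]: "g \<in> measurable M MX"
  shows "(\<lambda>\<omega>. knn_classifier \<tau> \<kappa> L n k (f \<omega>) (g \<omega>)) \<in> measurable M (count_space UNIV)"
proof -
  have "(\<lambda>\<omega>. knn_estimate \<kappa> n k (f \<omega>) (g \<omega>) l) \<in> borel_measurable M" for l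
  proof -
    have [measurable]: "Measurable.pred M (\<lambda>\<omega>. i \<in> \<kappa> {1..n} k (points n (f \<omega>)) (g \<omega>))" for i
      using k by (intro measurable_nn[OF \<kappa>] measurable_compose[OF f measurable_points] g) auto
    \<comment> \<open>The sum over a random index set becomes a sum over a fixed one, weighted by
      membership, whose measurability the neighbor rule provides.\<close>
    have eq: "knn_estimate \<kappa> n k (f \<omega>) (g \<omega>) l = (\<Sum>i\<in>{1..n}.
        of_bool (i \<in> \<kappa> {1..n} k (points n (f \<omega>)) (g \<omega>)) * of_bool (snd (f \<omega> i) = l)) / real k"
      if \<omega>: "\<omega> \<in> space M" for \<omega>
    proof -
      have "\<kappa> {1..n} k (points n (f \<omega>)) (g \<omega>) \<subseteq> {1..n}"
        using \<kappa> k points_in[OF measurable_space[OF f \<omega>]] measurable_space[OF g \<omega>]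
        unfolding nn_rule_def by (auto simp: space_restrict_space)
      then have "{1..n} \<inter> \<kappa> {1..n} k (points n (f \<omega>)) (g \<omega>) = \<kappa> {1..n} k (points n (f \<omega>)) (g \<omega>)" by blast
      then show ?thesis unfolding knn_estimate_def
        by (simp add: of_bool_def if_distrib[of "\<lambda>x. x * _"] sum.inter_restrict[symmetric] cong: if_cong)
    qed
    show ?thesis by (rule measurable_cong[THEN iffD2], rule eq) measurable
  qed
  then show ?thesis unfolding knn_classifier_def by (rule measurable_argmax_label)
qed

lemma nearest_index:
  assumes \<nu>: "nn_rule \<X> n \<nu>" and J: "J \<subseteq> {1..n}" "1 \<le> card J"
    and xs: "xs \<in> {1..n} \<rightarrow>\<^sub>E \<X>" and x: "x \<in> \<X>"
  obtains i where "i \<in> J" "\<nu> J 1 xs x = {i}"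
proof -
  have "\<nu> J 1 xs x \<subseteq> J \<and> card (\<nu> J 1 xs x) = 1"
    using \<nu> J xs x unfolding nn_rule_def by blast
  then show ?thesis using that by (metis card_1_singletonE insert_subset)
qed

text \<open>The index of the nearest neighbor takes finitely many values. For each fixed index the
  classifier is evaluated at a measurable point, and the pieces are glued along the measurable
  index.\<close>

lemma measurable_denoised_1nn:
  assumes \<kappa>: "nn_rule \<X> n \<kappa>" and \<nu>: "nn_rule \<X> n \<nu>" and k: "k \<in> {1..n}"
    and J: "J \<subseteq> {1..n}" "1 \<le> card J"
    and f[measurable]: "f \<in> measurable M (\<Pi>\<^sub>M i\<in>{1..n}. P)" and g[measurable]: "g \<in> measurable M MX"
  shows "(\<lambda>\<omega>. denoised_1nn \<tau> \<kappa> \<nu> L n k (f \<omega>) J (g \<omega>)) \<in> measurable M (count_space UNIV)"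
  unfolding denoised_1nn_def nearest_neighbor_def
proof (rule measurable_compose_countable'
    [where f = "\<lambda>j \<omega>. knn_classifier \<tau> \<kappa> L n k (f \<omega>) (fst (f \<omega> j))" and I = "{1..n}"])
  fix j assume "j \<in> {1..n}"
  then have [measurable]: "(\<lambda>zs. zs j) \<in> measurable (\<Pi>\<^sub>M i\<in>{1..n}. P) P"
    by (rule measurable_component_singleton)
  show "(\<lambda>\<omega>. knn_classifier \<tau> \<kappa> L n k (f \<omega>) (fst (f \<omega> j))) \<in> measurable M (count_space UNIV)"
    by (rule measurable_knn_classifier[OF \<kappa> k]) measurable
next
  define T where "T \<omega> = the_elem (\<nu> J 1 (points n (f \<omega>)) (g \<omega>))" for \<omega>
  have ix: "\<exists>i\<in>J. \<nu> J 1 (points n (f \<omega>)) (g \<omega>) = {i}" if \<omega>: "\<omega> \<in> space M" for \<omega>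
    using nearest_index[OF \<nu> J points_in[OF measurable_space[OF f \<omega>]], of "g \<omega>"]
      measurable_space[OF g \<omega>] by (auto simp: space_restrict_space)
  have T: "T \<omega> \<in> {1..n}" "\<And>j. T \<omega> = j \<longleftrightarrow> j \<in> \<nu> J 1 (points n (f \<omega>)) (g \<omega>)" if "\<omega> \<in> space M" for \<omega>
    using ix[OF that] J by (auto simp: T_def)
  have "T \<in> measurable M (count_space {1..n})"
  proof (subst measurable_count_space_eq2, safe)
    fix j
    have "T -` {j} \<inter> space M = {\<omega> \<in> space M. j \<in> \<nu> J 1 (points n (f \<omega>)) (g \<omega>)}"
      using T(2) unfolding vimage_def by blast
    also have "\<dots> \<in> sets M"
      using measurable_nn[OF \<nu> J(1) _ J(2) measurable_compose[OF f measurable_points] g, of j] by simp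
    finally show "T -` {j} \<inter> space M \<in> sets M" .
  qed (rule T(1), assumption | rule finite_atLeastAtMost)+
  then show "(\<lambda>\<omega>. the_elem (\<nu> J 1 (points n (f \<omega>)) (g \<omega>))) \<in> measurable M (count_space {1..n})"
    unfolding T_def[abs_def] .
qed simp

abbreviation index_sets :: "nat \<Rightarrow> nat \<Rightarrow> nat set set" where
  "index_sets n m \<equiv> {J. J \<subseteq> {1..n} \<and> card J = m}"

lemma finite_index_sets: "finite (index_sets n m)"
  by (rule finite_subset[of _ "Pow {1..n}"]) auto

text \<open>Draw and query point are arbitrary measurable functions on a common space because two
  instances are needed: a fixed draw with varying query point, to treat the rule as a classifier,
  and both varying jointly, for the error as a function of the draw.\<close>

lemma measurable_subnn:
  assumes \<kappa>: "nn_rule \<X> n \<kappa>" and \<nu>: "nn_rule \<X> n \<nu>" and k: "k \<in> {1..n}" and m: "1 \<le> m"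
    and [measurable]: "\<omega> \<in> measurable M (draw P n m I)" "g \<in> measurable M MX"
  shows "(\<lambda>x. subnn \<sigma> \<tau> \<kappa> \<nu> L n k I (fst (\<omega> x)) (snd (\<omega> x)) (g x)) \<in> measurable M (count_space UNIV)"
proof -
  have fst_\<omega>: "(\<lambda>x. fst (\<omega> x)) \<in> measurable M (\<Pi>\<^sub>M i\<in>{1..n}. P)"
    and snd_\<omega>: "(\<lambda>x. snd (\<omega> x)) \<in> measurable M (\<Pi>\<^sub>M i\<in>{1..I}. uniform_count_measure (index_sets n m))"
    using assms(5) unfolding draw_def by measurable
  have [measurable]: "(\<lambda>x. denoised_1nn \<tau> \<kappa> \<nu> L n k (fst (\<omega> x)) (snd (\<omega> x) i) (g x)) \<in> measurable M (count_space UNIV)"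
    if i: "i \<in> {1..I}" for i
  proof (rule measurable_compose_countable'[where I = "index_sets n m"])
    have "(\<lambda>x. snd (\<omega> x) i) \<in> measurable M (uniform_count_measure (index_sets n m))"
      by (rule measurable_compose[OF snd_\<omega> measurable_component_singleton[OF i]])
    then show "(\<lambda>x. snd (\<omega> x) i) \<in> measurable M (count_space (index_sets n m))"
      using measurable_cong_sets[OF refl sets_uniform_count_measure_count_space] by blast
    show "countable (index_sets n m)" using finite_index_sets by (rule countable_finite)
    fix J assume "J \<in> index_sets n m"
    then show "(\<lambda>x. denoised_1nn \<tau> \<kappa> \<nu> L n k (fst (\<omega> x)) J (g x)) \<in> measurable M (count_space UNIV)"
      using m by (intro measurable_denoised_1nn[OF \<kappa> \<nu> k _ _ fst_\<omega>]) auto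
  qed
  have "real (card {i \<in> {1..I}. D i = l}) = (\<Sum>i\<in>{1..I}. of_bool (D i = l))" for D and l :: nat
    by (simp add: Int_def)
  then show ?thesis
    unfolding subnn_def by (simp only:) (rule measurable_argmax_label, measurable)
qed

text \<open>The error is the measure of a section of a jointly measurable set. The fact is needed
  because \<open>measure\<close> is 0 on sets that are not measurable, so a lower bound for the
  final event requires its measurability.\<close>

lemma measurable_err_subnn:
  assumes \<kappa>: "nn_rule \<X> n \<kappa>" and \<nu>: "nn_rule \<X> n \<nu>" and k: "k \<in> {1..n}" and m: "1 \<le> m"
  shows "(\<lambda>\<omega>. err P (subnn \<sigma> \<tau> \<kappa> \<nu> L n k I (fst \<omega>) (snd \<omega>))) \<in> borel_measurable (draw P n m I)"
proof -
  let ?M = "draw P n m I" and ?h = "\<lambda>\<omega>. subnn \<sigma> \<tau> \<kappa> \<nu> L n k I (fst \<omega>) (snd \<omega>)"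
  define H where "H y = ?h (fst y) (fst (snd y))" for y :: "_ \<times> _ \<times> nat"
  have [measurable]: "H \<in> measurable (?M \<Otimes>\<^sub>M P) (count_space UNIV)"
    unfolding H_def[abs_def]
    by (rule measurable_subnn[OF assms, where \<omega> = fst and g = "\<lambda>y. fst (snd y)"])
      (rule measurable_fst, rule measurable_compose[OF measurable_snd measurable_fst_P])
  define Y where "Y y = snd (snd y)" for y :: "((nat \<Rightarrow> 'a \<times> nat) \<times> (nat \<Rightarrow> nat set)) \<times> 'a \<times> nat"
  have "Y \<in> measurable (?M \<Otimes>\<^sub>M P) (count_space UNIV)"
    unfolding Y_def[abs_def] by (rule measurable_compose[OF measurable_snd measurable_snd_P])
  then have [measurable]: "Measurable.pred (?M \<Otimes>\<^sub>M P) (\<lambda>y. H y \<noteq> Y y)"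
    by (rule measurable_compose_countable[where f = "\<lambda>l y. H y \<noteq> l", rotated]) measurable
  have "{y \<in> space (?M \<Otimes>\<^sub>M P). H y \<noteq> Y y} \<in> sets (?M \<Otimes>\<^sub>M P)" (is "?Q \<in> _")
    by measurable
  then have "(\<lambda>\<omega>. measure P (Pair \<omega> -` ?Q)) \<in> borel_measurable ?M"
    unfolding measure_def by (intro borel_measurable_enn2real measurable_emeasure_Pair)
  moreover have "Pair \<omega> -` ?Q = {z \<in> space P. ?h \<omega> (fst z) \<noteq> snd z}" if "\<omega> \<in> space ?M" for \<omega>
    using that by (auto simp: space_pair_measure H_def Y_def)
  ultimately show ?thesis
    unfolding err_def by (simp cong: measurable_cong)
qed


section \<open>Good samples and good subsamples\<close>

lemma hoelder_le:
  assumes "hoelder_condition \<X> L \<eta> lam \<alpha>" "x \<in> \<X>" "y \<in> \<X>" "dist x y \<le> r" "l \<in> {1..L}"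
  shows "\<bar>\<eta> x l - \<eta> y l\<bar> \<le> lam * r powr \<alpha>"
proof -
  have "\<bar>\<eta> x l - \<eta> y l\<bar> \<le> (MAX l\<in>{1..L}. \<bar>\<eta> x l - \<eta> y l\<bar>)"
    using assms(5) by (intro Max_ge) auto
  also have "\<dots> \<le> lam * norm (x - y) powr \<alpha>"
    using assms(1-3) unfolding hoelder_condition_def by blast
  also have "\<dots> \<le> lam * r powr \<alpha>"
    using assms(1,4) unfolding hoelder_condition_def
    by (intro mult_left_mono powr_mono2) (auto simp: dist_norm)
  finally show ?thesis .
qed

lemma nn_rule_props:
  assumes "nn_rule \<X> n \<kappa>" "k \<in> {1..n}" "xs \<in> {1..n} \<rightarrow>\<^sub>E \<X>" "x \<in> \<X>"
  shows "\<kappa> {1..n} k xs x \<subseteq> {1..n}" "card (\<kappa> {1..n} k xs x) = k"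
proof -
  have "1 \<le> k" "k \<le> card {1..n}" using assms(2) by auto
  then show "\<kappa> {1..n} k xs x \<subseteq> {1..n}" "card (\<kappa> {1..n} k xs x) = k"
    using assms(1,3,4) unfolding nn_rule_def by blast+
qed

lemma card_points_eq:
  assumes "J \<subseteq> {1..n}"
  shows "card {i \<in> J. dist x (points n zs i) \<le> r} = card {i \<in> J. dist x (fst (zs i)) \<le> r}"
proof -
  have "{i \<in> J. dist x (points n zs i) \<le> r} = {i \<in> J. dist x (fst (zs i)) \<le> r}"
    using assms unfolding points_def by (intro Collect_cong conj_cong) (auto simp: subset_iff)
  then show ?thesis by simp
qed

text \<open>The estimate is only ever evaluated at sample points. Given the points, these determine just
  \<open>n\<close> sets of neighbors, so that a union bound over them replaces a uniform law over all balls.\<close>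

lemma knn_estimate_at_sample:
  assumes mass: "mass_condition \<X> P d Cd" and hoelder: "hoelder_condition \<X> L \<eta> lam \<alpha>"
    and \<kappa>: "nn_rule \<X> n \<kappa>" and k: "k \<in> {1..n}" and \<epsilon>: "0 < \<epsilon>" and \<rho>: "0 < \<rho>"
  obtains E where "E \<in> sets (\<Pi>\<^sub>M i\<in>{1..n}. P)"
    "measure (\<Pi>\<^sub>M i\<in>{1..n}. P) E \<le> 2 ^ d / (Cd * \<rho> ^ d) * exp (real k - real n * (Cd * \<rho> ^ d) / 2)
      + 2 * real n * real L * exp (- (2 * real k * \<epsilon>\<^sup>2))"
    "\<And>zs j l. zs \<in> space (\<Pi>\<^sub>M i\<in>{1..n}. P) - E \<Longrightarrow> j \<in> {1..n} \<Longrightarrow> l \<in> {1..L} \<Longrightarrow>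
      \<bar>knn_estimate \<kappa> n k zs (fst (zs j)) l - \<eta> (fst (zs j)) l\<bar> \<le> \<epsilon> + lam * (2 * \<rho>) powr \<alpha>"
proof -
  interpret PI: prob_space "\<Pi>\<^sub>M i\<in>{1..n}. P" by (rule prob_space_sample)
  let ?M = "\<Pi>\<^sub>M i\<in>{1..n}. P"
  obtain E0 where E0: "E0 \<in> sets ?M"
    "PI.prob E0 \<le> 2 ^ d / (Cd * \<rho> ^ d) * exp (real k - real n * (Cd * \<rho> ^ d) / 2)"
    and many: "\<And>zs x. zs \<in> space ?M - E0 \<Longrightarrow> x \<in> \<X> \<Longrightarrow>
      k \<le> card {i \<in> {1..n}. dist x (fst (zs i)) \<le> 2 * \<rho>}"
    using uniform_cover[OF mass _ subset_refl _ \<rho>, of "{1..n}" k] k by auto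
  \<comment> \<open>Membership among the neighbors of the \<open>j\<close>-th point is a function of
    the points alone, as the conditional Hoeffding bound demands of its weights.\<close>
  define w where "w j i xs \<longleftrightarrow> i \<in> \<kappa> {1..n} k xs (xs j)" for j i :: nat and xs :: "nat \<Rightarrow> 'a"
  define S where "S j l zs = (\<Sum>i\<in>{1..n}. of_bool (w j i (points n zs)) *
    (of_bool (snd (zs i) = l) - \<eta> (fst (zs i)) l))" for j l zs
  define H where "H j l = {zs \<in> space ?M. real k * \<epsilon> \<le> \<bar>S j l zs\<bar>}" for j l
  have H: "H j l \<in> sets ?M" "PI.prob (H j l) \<le> 2 * exp (- (2 * real k * \<epsilon>\<^sup>2))"
    if j: "j \<in> {1..n}" and l: "l \<in> {1..L}" for j l
  proof -
    have w: "Measurable.pred (\<Pi>\<^sub>M i\<in>{1..n}. MX) (w j i)" for i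
      unfolding w_def using k
      by (intro measurable_nn[OF \<kappa>] measurable_ident measurable_component_singleton j) auto
    have card: "card {i \<in> {1..n}. w j i xs} = k" if xs: "xs \<in> {1..n} \<rightarrow>\<^sub>E \<X>" for xs
    proof -
      have "xs j \<in> \<X>" using xs j by auto
      note K = nn_rule_props[OF \<kappa> k xs this]
      have "{i \<in> {1..n}. w j i xs} = \<kappa> {1..n} k xs (xs j)" using K(1) unfolding w_def by blast
      then show ?thesis using K(2) by simp
    qed
    show "H j l \<in> sets ?M" "PI.prob (H j l) \<le> 2 * exp (- (2 * real k * \<epsilon>\<^sup>2))"
      unfolding H_def S_def points_def
      by (intro conditional_Hoeffding[OF _ l w card \<epsilon>] finite_atLeastAtMost, assumption)+
  qed
  define E where "E = E0 \<union> (\<Union>(j, l)\<in>{1..n} \<times> {1..L}. H j l)"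
  show ?thesis
  proof (rule that[of E])
    have Hs: "(\<lambda>(j, l). H j l) ` ({1..n} \<times> {1..L}) \<subseteq> sets ?M" using H(1) by auto
    show "E \<in> sets ?M" unfolding E_def using E0(1) Hs by (intro sets.Un sets.finite_UN) auto
    have "PI.prob E \<le> PI.prob E0 + PI.prob (\<Union>(j, l)\<in>{1..n} \<times> {1..L}. H j l)"
      unfolding E_def using E0(1) Hs by (intro measure_Un_le sets.finite_UN) auto
    also have "PI.prob (\<Union>(j, l)\<in>{1..n} \<times> {1..L}. H j l) \<le> (\<Sum>(j, l)\<in>{1..n} \<times> {1..L}. PI.prob (H j l))"
      using PI.finite_measure_subadditive_finite[OF _ Hs] by (simp add: case_prod_unfold)
    also have "\<dots> \<le> (\<Sum>(j, l)\<in>{1..n} \<times> {1..L}. 2 * exp (- (2 * real k * \<epsilon>\<^sup>2)))"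
      using H(2) by (intro sum_mono) auto
    also have "\<dots> = 2 * real n * real L * exp (- (2 * real k * \<epsilon>\<^sup>2))"
      by (simp add: case_prod_unfold)
    finally show "PI.prob E \<le> 2 ^ d / (Cd * \<rho> ^ d) * exp (real k - real n * (Cd * \<rho> ^ d) / 2)
      + 2 * real n * real L * exp (- (2 * real k * \<epsilon>\<^sup>2))" using E0(2) by simp
    fix zs j l assume zsE: "zs \<in> space ?M - E" and j: "j \<in> {1..n}" and l: "l \<in> {1..L}"
    then have zs: "zs \<in> space ?M" and far: "zs \<notin> E0" "zs \<notin> H j l" by (auto simp: E_def)
    have ps: "points n zs \<in> {1..n} \<rightarrow>\<^sub>E \<X>" using points_in[OF zs] .
    have x: "fst (zs j) \<in> \<X>" using point_in[OF zs j] .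
    define K where "K = \<kappa> {1..n} k (points n zs) (fst (zs j))"
    have K: "K \<subseteq> {1..n}" "card K = k" unfolding K_def using nn_rule_props[OF \<kappa> k ps x] .
    have k0: "0 < real k" using k by simp
    have "S j l zs = (\<Sum>i\<in>{1..n}. if i \<in> K then of_bool (snd (zs i) = l) - \<eta> (fst (zs i)) l else 0)"
      unfolding S_def using j by (intro sum.cong) (auto simp: w_def K_def points_def)
    also have "\<dots> = (\<Sum>i\<in>K. of_bool (snd (zs i) = l) - \<eta> (fst (zs i)) l)"
      using K(1) by (simp add: sum.inter_restrict[symmetric] Int_absorb1)
    finally have S: "S j l zs = \<dots>" .
    have dev: "\<bar>S j l zs\<bar> \<le> real k * \<epsilon>" using far zs by (auto simp: H_def)
    \<comment> \<open>At least \<open>k\<close> sample points lie within \<open>2 * \<rho>\<close>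
      of the query point, so all selected neighbors do, and the Hoelder condition bounds each
      term.\<close>
    have bias: "\<bar>\<Sum>i\<in>K. \<eta> (fst (zs i)) l - \<eta> (fst (zs j)) l\<bar> \<le> real k * (lam * (2 * \<rho>) powr \<alpha>)"
    proof -
      have "\<bar>\<eta> (fst (zs i)) l - \<eta> (fst (zs j)) l\<bar> \<le> lam * (2 * \<rho>) powr \<alpha>" if i: "i \<in> K" for i
      proof (rule hoelder_le[OF hoelder _ x _ l])
        show "fst (zs i) \<in> \<X>" using point_in[OF zs] i K(1) by blast
        have near: "k \<le> card {i \<in> {1..n}. dist (fst (zs j)) (points n zs i) \<le> 2 * \<rho>}"
          unfolding card_points_eq[OF subset_refl] by (rule many) (use zs far(1) x in auto)
        have "dist (fst (zs j)) (points n zs i) \<le> 2 * \<rho>"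
          by (rule nn_rule_dist_le[OF \<kappa> subset_refl _ ps x near]) (use k i in \<open>auto simp: K_def\<close>)
        then show "dist (fst (zs i)) (fst (zs j)) \<le> 2 * \<rho>"
          using i K(1) by (auto simp: points_def dist_commute)
      qed
      then have le: "(\<Sum>i\<in>K. \<bar>\<eta> (fst (zs i)) l - \<eta> (fst (zs j)) l\<bar>) \<le> (\<Sum>i\<in>K. lam * (2 * \<rho>) powr \<alpha>)"
        by (intro sum_mono) auto
      show ?thesis by (rule order_trans[OF sum_abs order_trans[OF le]]) (simp add: K(2))
    qed
    let ?e = "knn_estimate \<kappa> n k zs (fst (zs j)) l - \<eta> (fst (zs j)) l"
    \<comment> \<open>Up to the factor \<open>k\<close>, the error of the estimate is the deviation
      of the labels from their conditional means plus the bias from evaluating \<eta> at the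
      neighbors.\<close>
    have "real k * ?e = S j l zs + (\<Sum>i\<in>K. \<eta> (fst (zs i)) l - \<eta> (fst (zs j)) l)"
      unfolding S knn_estimate_def K_def[symmetric]
      using k0 K(2) by (simp add: sum_subtractf algebra_simps del: sum_of_bool_eq)
    then have "real k * \<bar>?e\<bar> = \<bar>S j l zs + (\<Sum>i\<in>K. \<eta> (fst (zs i)) l - \<eta> (fst (zs j)) l)\<bar>"
      by (metis abs_mult abs_of_nat)
    also have "\<dots> \<le> real k * \<epsilon> + real k * (lam * (2 * \<rho>) powr \<alpha>)"
      using abs_triangle_ineq add_mono[OF dev bias] by (rule order_trans)
    finally have "real k * \<bar>?e\<bar> \<le> real k * (\<epsilon> + lam * (2 * \<rho>) powr \<alpha>)"
      by (simp only: distrib_left)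
    then show "\<bar>knn_estimate \<kappa> n k zs (fst (zs j)) l - \<eta> (fst (zs j)) l\<bar> \<le> \<epsilon> + lam * (2 * \<rho>) powr \<alpha>"
      using k0 by simp
  qed
qed

text \<open>The rule predicts at \<open>x\<close> what the estimate prefers at a nearby sample
  point. Going there and back costs the Hoelder bound twice; replacing \<eta> by the estimate, for
  \<open>l\<close> and for the predicted label, costs \<open>e\<close> twice.\<close>

lemma denoised_1nn_near_optimal:
  assumes L: "L \<ge> 1" and hoelder: "hoelder_condition \<X> L \<eta> lam \<alpha>"
    and \<nu>: "nn_rule \<X> n \<nu>" and \<tau>: "tie_rule L \<tau>" and J: "J \<subseteq> {1..n}" "1 \<le> card J"
    and zs: "zs \<in> space (\<Pi>\<^sub>M i\<in>{1..n}. P)"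
    and est: "\<And>j l. j \<in> {1..n} \<Longrightarrow> l \<in> {1..L} \<Longrightarrow>
      \<bar>knn_estimate \<kappa> n k zs (fst (zs j)) l - \<eta> (fst (zs j)) l\<bar> \<le> e"
    and x: "x \<in> \<X>" and near: "1 \<le> card {i \<in> J. dist x (fst (zs i)) \<le> r}" and l: "l \<in> {1..L}"
  shows "\<eta> x l \<le> \<eta> x (denoised_1nn \<tau> \<kappa> \<nu> L n k zs J x) + (2 * e + 2 * (lam * r powr \<alpha>))"
proof -
  have ps: "points n zs \<in> {1..n} \<rightarrow>\<^sub>E \<X>" using points_in[OF zs] .
  obtain i where i: "i \<in> J" "\<nu> J 1 (points n zs) x = {i}"
    using nearest_index[OF \<nu> J ps x] by blast
  define x' where "x' = fst (zs i)"
  define a where "a = denoised_1nn \<tau> \<kappa> \<nu> L n k zs J x"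
  have a: "a = argmax_label \<tau> L (knn_estimate \<kappa> n k zs x')"
    unfolding a_def denoised_1nn_def nearest_neighbor_def knn_classifier_def i(2) x'_def by simp
  have aL: "a \<in> {1..L}" and max: "knn_estimate \<kappa> n k zs x' l \<le> knn_estimate \<kappa> n k zs x' a"
    unfolding a using argmax_label[OF \<tau> L] l by auto
  have i': "i \<in> {1..n}" using i J by blast
  have x': "x' \<in> \<X>" using point_in[OF zs i'] by (simp add: x'_def)
  have "dist x (points n zs i) \<le> r"
    using nn_rule_dist_le[OF \<nu> J(1) _ ps x, of 1 r i] near i by (simp add: card_points_eq[OF J(1)])
  then have "dist x x' \<le> r" using i' by (simp add: points_def x'_def)
  then have h: "\<bar>\<eta> x b - \<eta> x' b\<bar> \<le> lam * r powr \<alpha>" if "b \<in> {1..L}" for b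
    using hoelder_le[OF hoelder x x' _ that] by simp
  show ?thesis
    using h[OF l] h[OF aL] est[OF i' l] est[OF i' aL] max
    unfolding a_def[symmetric] x'_def[symmetric] by linarith
qed

section \<open>The joint law of the sample and the subsamples\<close>

lemma prob_space_draw:
  assumes "m \<le> n"
  shows "prob_space (draw P n m I)"
proof -
  have "{1..m} \<in> index_sets n m" using assms by simp
  then have U: "prob_space (uniform_count_measure (index_sets n m))"
    by (intro prob_space_uniform_count_measure finite_index_sets) blast
  interpret M1: prob_space "\<Pi>\<^sub>M i\<in>{1..n}. P" by (rule prob_space_sample)
  interpret M2: prob_space "\<Pi>\<^sub>M i\<in>{1..I}. uniform_count_measure (index_sets n m)"
    by (rule prob_space_PiM) (rule U)
  show ?thesis unfolding draw_def
    by (rule prob_space_pair) (rule M1.prob_space_axioms M2.prob_space_axioms)+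
qed

lemma space_draw: "space (draw P n m I) =
    space (\<Pi>\<^sub>M i\<in>{1..n}. P) \<times> ({1..I} \<rightarrow>\<^sub>E index_sets n m)"
  by (simp add: draw_def space_pair_measure space_PiM space_uniform_count_measure)

text \<open>The index sets are independent of the sample. With them held fixed, the section of the
  event lies in the exceptional set of one fixed \<open>J\<close>, whose probability is at most
  \<open>p\<close>.\<close>

lemma draw_bad_subsample:
  assumes m: "m \<le> n" and i: "i \<in> {1..I}"
    and E: "\<And>J. J \<in> index_sets n m \<Longrightarrow> E J \<in> sets (\<Pi>\<^sub>M i\<in>{1..n}. P)"
    and p: "\<And>J. J \<in> index_sets n m \<Longrightarrow> measure (\<Pi>\<^sub>M i\<in>{1..n}. P) (E J) \<le> p"
  shows "{\<omega> \<in> space (draw P n m I). fst \<omega> \<in> E (snd \<omega> i)} \<in> sets (draw P n m I)" (is "?A \<in> _")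
    and "measure (draw P n m I) {\<omega> \<in> space (draw P n m I). fst \<omega> \<in> E (snd \<omega> i)} \<le> p"
proof -
  have ne: "{1..m} \<in> index_sets n m" using m by simp
  have U: "prob_space (uniform_count_measure (index_sets n m))"
    using ne by (intro prob_space_uniform_count_measure finite_index_sets) blast
  interpret D: prob_space "draw P n m I" by (rule prob_space_draw[OF m])
  define M1 where "M1 = (\<Pi>\<^sub>M i\<in>{1..n}. P)"
  define M2 where "M2 = (\<Pi>\<^sub>M i\<in>{1..I}. uniform_count_measure (index_sets n m))"
  interpret M1: prob_space M1 unfolding M1_def by (rule prob_space_sample)
  interpret M2: prob_space M2 unfolding M2_def by (rule prob_space_PiM) (rule U)
  interpret pair_prob_space M1 M2 by standard
  have draw: "draw P n m I = M1 \<Otimes>\<^sub>M M2" by (simp add: draw_def M1_def M2_def)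
  have comp: "(\<lambda>\<omega>. snd \<omega> i) \<in> measurable (M1 \<Otimes>\<^sub>M M2) (count_space (index_sets n m))"
  proof -
    have "(\<lambda>\<omega>. snd \<omega> i) \<in> measurable (M1 \<Otimes>\<^sub>M M2) (uniform_count_measure (index_sets n m))"
      unfolding M2_def by (rule measurable_compose[OF measurable_snd measurable_component_singleton[OF i]])
    then show ?thesis
      using measurable_cong_sets[OF refl sets_uniform_count_measure_count_space] by blast
  qed
  have "Measurable.pred (M1 \<Otimes>\<^sub>M M2) (\<lambda>\<omega>. fst \<omega> \<in> E (snd \<omega> i))"
  proof (rule measurable_compose_countable'[OF _ comp countable_finite[OF finite_index_sets]])
    fix J assume "J \<in> index_sets n m"
    then have [measurable]: "E J \<in> sets M1" using E by (simp add: M1_def)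
    show "Measurable.pred (M1 \<Otimes>\<^sub>M M2) (\<lambda>\<omega>. fst \<omega> \<in> E J)" by measurable
  qed
  then show A: "?A \<in> sets (draw P n m I)" unfolding draw by measurable
  have "emeasure (M1 \<Otimes>\<^sub>M M2) ?A = (\<integral>\<^sup>+Js. emeasure M1 ((\<lambda>zs. (zs, Js)) -` ?A) \<partial>M2)"
    using A unfolding draw by (rule emeasure_pair_measure_alt2)
  also have "\<dots> \<le> (\<integral>\<^sup>+Js. ennreal p \<partial>M2)"
  proof (rule nn_integral_mono)
    fix Js assume Js: "Js \<in> space M2"
    then have J: "Js i \<in> index_sets n m" using i by (simp add: M2_def space_PiM PiE_iff space_uniform_count_measure)
    have "(\<lambda>zs. (zs, Js)) -` ?A \<subseteq> E (Js i)" by auto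
    then have "emeasure M1 ((\<lambda>zs. (zs, Js)) -` ?A) \<le> emeasure M1 (E (Js i))"
      using E[OF J] by (intro emeasure_mono) (auto simp: M1_def)
    also have "\<dots> \<le> ennreal p"
      using p[OF J] unfolding M1.emeasure_eq_measure M1_def[symmetric] by (intro ennreal_leI)
    finally show "emeasure M1 ((\<lambda>zs. (zs, Js)) -` ?A) \<le> ennreal p" .
  qed
  also have "\<dots> = ennreal p" by (simp add: M2.emeasure_space_1)
  finally have "emeasure (draw P n m I) ?A \<le> ennreal p" by (simp add: draw)
  moreover have "0 \<le> p" using p[OF ne] measure_nonneg by (meson order_trans)
  ultimately show "D.prob ?A \<le> p" by (simp add: D.emeasure_eq_measure)
qed

text \<open>Bounding the fraction of bad subsamples by Markov's inequality, instead of asking that all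
  subsamples be good, is what keeps the bound free of the number \<open>I\<close> of subsamples.\<close>

lemma draw_many_bad_subsamples:
  fixes p :: real
  assumes m: "m \<le> n" and I: "1 \<le> I" and L: "1 \<le> L"
    and E: "\<And>J. J \<in> index_sets n m \<Longrightarrow> E J \<in> sets (\<Pi>\<^sub>M i\<in>{1..n}. P)"
    and p: "\<And>J. J \<in> index_sets n m \<Longrightarrow> measure (\<Pi>\<^sub>M i\<in>{1..n}. P) (E J) \<le> p"
  defines "B \<equiv> {\<omega> \<in> space (draw P n m I). I \<le> L * card {i \<in> {1..I}. fst \<omega> \<in> E (snd \<omega> i)}}"
  shows "B \<in> sets (draw P n m I)" and "measure (draw P n m I) B \<le> real L * p"
proof -
  interpret D: prob_space "draw P n m I" by (rule prob_space_draw[OF m])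
  define A where "A i = {\<omega> \<in> space (draw P n m I). fst \<omega> \<in> E (snd \<omega> i)}" for i
  have A: "A i \<in> D.events" "D.prob (A i) \<le> p" if "i \<in> {1..I}" for i
    using draw_bad_subsample[OF m that E p] unfolding A_def by auto
  \<comment> \<open>The count of bad subsamples has mean at most \<open>I * p\<close> by linearity,
    although the subsamples share one sample. Markov's inequality at level \<open>I / L\<close> then
    gives \<open>L * p\<close>.\<close>
  define u where "u \<omega> = (\<Sum>i\<in>{1..I}. indicator (A i) \<omega> :: real)" for \<omega>
  have int: "integrable (draw P n m I) (indicator (A i) :: _ \<Rightarrow> real)" if "i \<in> {1..I}" for i
    using A(1)[OF that] by (intro integrable_real_indicator) (simp_all add: less_top[symmetric])
  have int_u: "integrable (draw P n m I) u"
    unfolding u_def using int by (intro Bochner_Integration.integrable_sum) auto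
  have u: "u \<omega> = real (card {i \<in> {1..I}. fst \<omega> \<in> E (snd \<omega> i)})" if "\<omega> \<in> space (draw P n m I)" for \<omega>
    using that by (simp add: u_def A_def indicator_def Int_def)
  have B: "B = {\<omega> \<in> space (draw P n m I). real I / real L \<le> u \<omega>}"
  proof -
    have "I \<le> L * c \<longleftrightarrow> real I / real L \<le> real c" for c
      using L by (simp add: pos_divide_le_eq mult.commute flip: of_nat_mult)
    then show ?thesis unfolding B_def using u by auto
  qed
  have [measurable]: "u \<in> borel_measurable (draw P n m I)" using int_u by auto
  show "B \<in> D.events" unfolding B by measurable
  have "D.prob B \<le> (\<integral>\<omega>. u \<omega> \<partial>draw P n m I) / (real I / real L)"
    unfolding B using I L
    by (intro integral_Markov_inequality_measure[OF int_u sets.top]) (auto simp: u_def intro: sum_nonneg)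
  also have "(\<integral>\<omega>. u \<omega> \<partial>draw P n m I) = (\<Sum>i\<in>{1..I}. D.prob (A i))"
  proof -
    have "(\<integral>\<omega>. u \<omega> \<partial>draw P n m I) = (\<Sum>i\<in>{1..I}. \<integral>\<omega>. indicator (A i) \<omega> \<partial>draw P n m I)"
      unfolding u_def using int by (intro Bochner_Integration.integral_sum) auto
    also have "\<dots> = (\<Sum>i\<in>{1..I}. D.prob (A i))"
      using sets.sets_into_space[OF A(1)] by (intro sum.cong) (simp_all add: Int_absorb2)
    finally show ?thesis .
  qed
  also have "\<dots> \<le> (\<Sum>i\<in>{1..I}. p)" using A(2) by (intro sum_mono) auto
  also have "(\<Sum>i\<in>{1..I}. p) / (real I / real L) = real L * p" using I L by simp
  finally show "D.prob B \<le> real L * p" using I L by (simp add: divide_right_mono)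
qed

end

section \<open>Choice of the parameters\<close>

text \<open>Here \<open>a\<close> stands for the ball mass \<open>Cd * r ^ d\<close>. Its factor d +
  2 leaves d + 1 powers of q = \<delta> / (L * n): \<open>d\<close> of them absorb 2^d because 2 * q
  \<le> 1, and the last turns the factor \<open>n\<close> into \<delta> / L.\<close>

lemma sample_failure_le:
  fixes \<delta> :: real and n L k d :: nat
  assumes n: "1 \<le> n" and L: "2 \<le> L" and \<delta>: "0 < \<delta>" "\<delta> \<le> 1 / 2" and k: "1 \<le> k"
    and kl: "ln (real L * real n / \<delta>) \<le> real k"
  defines "a \<equiv> 2 * (real d + 2) * real k / real n"
  shows "2 ^ d / a * exp (real k - real n * a / 2) \<le> \<delta> / 2"
proof -
  define q where "q = \<delta> / (real L * real n)"
  have q0: "0 < q" using n L \<delta> by (simp add: q_def)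
  have "1 * 1 \<le> real L * real n" using n L by (intro mult_mono) auto
  then have q: "2 * q \<le> 1" using n L \<delta> by (simp add: q_def pos_divide_le_eq)
  have e: "exp (- ln (real L * real n / \<delta>)) = q"
    using n L \<delta> by (simp add: exp_minus q_def)
  have "real k - real n * a / 2 = - (real (d + 1) * real k)"
  proof -
    have "real n * a / 2 = (real d + 2) * real k" using n by (simp add: a_def)
    then show ?thesis by (simp add: algebra_simps)
  qed
  also have "\<dots> \<le> - (real (d + 1) * ln (real L * real n / \<delta>))"
    using kl by (simp add: mult_left_mono del: of_nat_add)
  finally have "exp (real k - real n * a / 2) \<le> exp (real (d + 1) * - ln (real L * real n / \<delta>))"
    by simp
  also have "\<dots> = q ^ (d + 1)" by (simp only: exp_of_nat_mult e)
  finally have exp: "exp (real k - real n * a / 2) \<le> q ^ (d + 1)" .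
  have "1 * 1 \<le> (2 * (real d + 2)) * real k" using k by (intro mult_mono) auto
  then have "1 / real n \<le> a" using n by (simp add: a_def divide_right_mono)
  moreover from this have "0 < a" using n by (intro less_le_trans[of 0 "1 / real n" a]) simp_all
  ultimately have "2 ^ d / a \<le> 2 ^ d / (1 / real n)"
    using n by (intro divide_left_mono mult_pos_pos) simp_all
  then have "2 ^ d / a * exp (real k - real n * a / 2) \<le> (2 ^ d * real n) * q ^ (d + 1)"
    using exp by (intro mult_mono) auto
  also have "\<dots> = (real n * q) * (2 * q) ^ d" by (simp add: power_mult_distrib)
  also have "\<dots> \<le> (real n * q) * 1"
    using q0 q by (intro mult_left_mono power_le_one) auto
  also have "\<dots> = \<delta> / real L" using n by (simp add: q_def)
  also have "\<dots> \<le> \<delta> / 2" using L \<delta> by (intro divide_left_mono) auto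
  finally show ?thesis .
qed

text \<open>The Hoeffding exponent is twice the logarithm. One power of q = \<delta> / (L * n) pays
  for the union over points and labels, and the other is at most 1 / 4.\<close>

lemma deviation_failure_le:
  fixes \<delta> :: real and n L :: nat
  assumes n: "1 \<le> n" and L: "2 \<le> L" and \<delta>: "0 < \<delta>" "\<delta> \<le> 1 / 2"
  shows "2 * real n * real L * exp (- (2 * ln (real L * real n / \<delta>))) \<le> \<delta> / 2"
proof -
  define q where "q = \<delta> / (real L * real n)"
  have q0: "0 < q" using n L \<delta> by (simp add: q_def)
  have "2 * 1 \<le> real L * real n" using n L by (intro mult_mono) auto
  then have q: "q \<le> 1 / 4" using n L \<delta> by (simp add: q_def pos_divide_le_eq)
  have "exp (- (2 * ln (real L * real n / \<delta>))) = exp (- ln (real L * real n / \<delta>)) ^ 2"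
    by (simp add: power2_eq_square flip: exp_add)
  also have "exp (- ln (real L * real n / \<delta>)) = q"
    using n L \<delta> by (simp add: exp_minus q_def)
  finally have "2 * real n * real L * exp (- (2 * ln (real L * real n / \<delta>)))
      = 2 * (real L * real n * q) * q"
    by (simp add: power2_eq_square)
  also have "real L * real n * q = \<delta>" using n L by (simp add: q_def)
  also have "2 * \<delta> * q \<le> 2 * \<delta> * (1 / 4)" using q \<delta> by (intro mult_left_mono) auto
  finally show ?thesis by simp
qed

text \<open>The logarithm contains no \<open>L\<close>, so the factor \<open>L\<close> from Markov's
  inequality is charged to the constant in \<open>a\<close>. Of the d + L + 3 powers of q = \<delta>
  / m, \<open>d\<close> absorb 2^d, \<open>L\<close> absorb L \<le> 2^L, two absorb exp 1 \<le> 4,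
  and one absorbs \<open>m\<close>.\<close>

lemma subsample_failure_le:
  fixes \<delta> :: real and m L d :: nat
  assumes m: "1 \<le> m" and \<delta>: "0 < \<delta>" "\<delta> \<le> 1 / 2"
  defines "a \<equiv> 2 * (real d + real L + 3) * (ln (real m / \<delta>) / real m)"
  shows "real L * (2 ^ d / a * exp (1 - real m * a / 2)) \<le> \<delta>"
proof -
  define q where "q = \<delta> / real m"
  have q0: "0 < q" using m \<delta> by (simp add: q_def)
  have q: "2 * q \<le> 1" using m \<delta> by (simp add: q_def pos_divide_le_eq)
  have e: "exp (- ln (real m / \<delta>)) = q" using m \<delta> by (simp add: exp_minus q_def)
  have "2 \<le> real m / \<delta>" using m \<delta> by (simp add: pos_le_divide_eq)
  then have "ln 2 \<le> ln (real m / \<delta>)" by simp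
  then have l: "1 / 2 \<le> ln (real m / \<delta>)" using ln2_ge_two_thirds by simp
  have "real m * a / 2 = real (d + L + 3) * ln (real m / \<delta>)" using m by (simp add: a_def)
  then have "exp (1 - real m * a / 2) = exp (1 + real (d + L + 3) * - ln (real m / \<delta>))" by simp
  also have "\<dots> = exp 1 * q ^ (d + L + 3)" by (simp only: exp_add exp_of_nat_mult e)
  also have "\<dots> \<le> 4 * q ^ (d + L + 3)" using q0 exp_le by (intro mult_right_mono) auto
  finally have exp: "exp (1 - real m * a / 2) \<le> 4 * q ^ (d + L + 3)" .
  have "2 * (1 / 2) \<le> (2 * (real d + real L + 3)) * ln (real m / \<delta>)" using l by (intro mult_mono) auto
  then have "1 / real m \<le> a" using m by (simp add: a_def divide_right_mono)
  moreover from this have "0 < a" using m by (intro less_le_trans[of 0 "1 / real m" a]) simp_all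
  ultimately have "2 ^ d / a \<le> 2 ^ d / (1 / real m)"
    using m by (intro divide_left_mono mult_pos_pos) simp_all
  then have "2 ^ d / a * exp (1 - real m * a / 2) \<le> (2 ^ d * real m) * (4 * q ^ (d + L + 3))"
    using exp by (intro mult_mono) auto
  then have "real L * (2 ^ d / a * exp (1 - real m * a / 2))
      \<le> real L * ((2 ^ d * real m) * (4 * q ^ (d + L + 3)))"
    by (intro mult_left_mono) auto
  also have "\<dots> = (real m * q) * ((2 * q) ^ d * (2 * q) ^ 2 * (real L * q ^ L))"
    by (simp add: power_mult_distrib power_add power2_eq_square power3_eq_cube)
  also have "\<dots> \<le> (real m * q) * 1"
  proof -
    have "real L * q ^ L \<le> 2 ^ L * q ^ L"
      using q0 of_nat_less_two_power[of L, where 'a = real] by (intro mult_right_mono) simp_all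
    also have "\<dots> = (2 * q) ^ L" by (rule power_mult_distrib[symmetric])
    also have "\<dots> \<le> 1" using q0 q by (intro power_le_one) simp_all
    finally have Lq: "real L * q ^ L \<le> 1" .
    have pw: "(2 * q) ^ i \<le> 1" for i using q0 q by (intro power_le_one) simp_all
    have "(2 * q) ^ d * (2 * q) ^ 2 * (real L * q ^ L) \<le> 1"
      by (rule mult_le_one[OF mult_le_one[OF pw _ pw] _ Lq]) (use q0 in simp_all)
    then show ?thesis using q0 by (intro mult_left_mono) simp_all
  qed
  also have "\<dots> = \<delta>" using m by (simp add: q_def)
  finally show ?thesis .
qed

text \<open>The number of neighbors balances the deviation \<open>sqrt (l / k)\<close> against the bias
  \<open>(k / n) powr (\<alpha> / d)\<close>.\<close>

lemma neighbors_choice: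
  fixes l \<alpha> :: real and n d :: nat
  assumes n: "1 \<le> n" and l: "1 \<le> l" "l \<le> real n" and \<alpha>: "0 < \<alpha>" and d: "1 \<le> d"
  defines "u \<equiv> l / real n" and "\<gamma> \<equiv> 2 * \<alpha> + real d"
  defines "k \<equiv> nat \<lceil>real n * u powr (real d / \<gamma>)\<rceil>"
  shows "k \<in> {1..n}" "l \<le> real k" "real k \<le> 2 * real n * u powr (real d / \<gamma>)"
    "sqrt (l / real k) \<le> u powr (\<alpha> / \<gamma>)"
proof -
  have u: "0 < u" "u \<le> 1" using n l by (simp_all add: u_def)
  have \<gamma>: "0 < \<gamma>" "real d \<le> \<gamma>" using \<alpha> d by (simp_all add: \<gamma>_def)
  let ?x = "real n * u powr (real d / \<gamma>)"
  \<comment> \<open>Since \<open>u \<le> 1\<close>, lowering the exponent from 1 to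
    \<open>d / \<gamma>\<close> increases the power; hence \<open>l = n * u\<close> is at most the
    number that is rounded up to \<open>k\<close>.\<close>
  have "u powr 1 \<le> u powr (real d / \<gamma>)" using u \<gamma> by (intro powr_mono') auto
  then have "real n * u \<le> ?x" using u by (intro mult_left_mono) auto
  then have lx: "l \<le> ?x" using n by (simp add: u_def)
  have kx: "?x \<le> real k" unfolding k_def by linarith
  \<comment> \<open>Rounding up adds at most 1, which is below \<open>l\<close> and so below the
    rounded number; this is the origin of the factor 2.\<close>
  have kx1: "real k \<le> ?x + 1" unfolding k_def using lx l by linarith
  show lk: "l \<le> real k" using lx kx by simp
  show "real k \<le> 2 * real n * u powr (real d / \<gamma>)" using kx1 lx l by simp
  have "u powr (real d / \<gamma>) \<le> 1" using u \<gamma> by (intro powr_le1) auto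
  then have "?x \<le> real n" using n by (simp add: mult_left_le)
  then have "k \<le> n" unfolding k_def by linarith
  moreover have "1 \<le> k" using lk l by simp
  ultimately show "k \<in> {1..n}" by simp
  have "l / real k \<le> l / ?x"
    using kx lx l by (intro divide_left_mono) auto
  also have "\<dots> = u powr (1 - real d / \<gamma>)"
    using u n by (simp add: powr_diff) (simp add: u_def)
  also have "1 - real d / \<gamma> = 2 * (\<alpha> / \<gamma>)" using \<gamma> by (simp add: \<gamma>_def field_simps)
  also have "u powr (2 * (\<alpha> / \<gamma>)) = (u powr (\<alpha> / \<gamma>)) ^ 2"
    using u by (simp add: power2_eq_square flip: powr_add)
  finally show "sqrt (l / real k) \<le> u powr (\<alpha> / \<gamma>)" by (intro real_le_lsqrt) simp_all
qed

lemma powr_root_power: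
  fixes s :: real
  assumes "0 < s" "1 \<le> d"
  shows "(s powr (1 / real d)) ^ d = s"
  using assms by (simp add: powr_powr flip: powr_realpow)

lemma powr_scaled_root:
  fixes c s :: real
  assumes "0 < c" "0 \<le> s"
  shows "(2 * (c * s) powr (1 / real d)) powr \<alpha> = (2 * c powr (1 / real d)) powr \<alpha> * s powr (\<alpha> / real d)"
  using assms by (simp add: powr_mult powr_powr)

lemma powr_sum_le:
  fixes a b p :: real
  assumes "0 \<le> a" "0 \<le> b" "0 \<le> p"
  shows "(a + b) powr p \<le> 2 powr p * (a powr p + b powr p)"
proof -
  have "(a + b) powr p \<le> (2 * max a b) powr p" using assms by (intro powr_mono2) auto
  also have "\<dots> = 2 powr p * (max a b) powr p" using assms by (simp add: powr_mult)
  also have "\<dots> \<le> 2 powr p * (a powr p + b powr p)"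
    by (intro mult_left_mono) (auto simp: max_def)
  finally show ?thesis .
qed

section \<open>Regret bound and rate of the subsampled rule\<close>

context classification
begin

lemma err_diff_le_1: "err P h - err P h' \<le> 1"
  unfolding err_def using prob_le_1[of "{z \<in> space P. h (fst z) \<noteq> snd z}"]
    measure_nonneg[of P "{z \<in> space P. h' (fst z) \<noteq> snd z}"] by linarith

text \<open>The parameters stay free so that the probabilistic argument is separate from the
  optimization: \<open>r\<close> is the scale at which the sample holds \<open>k\<close> points,
  \<open>s\<close> the scale at which a subsample holds one, and \<epsilon> the deviation allowed to
  the labels.\<close>

lemma subnn_regret:
  assumes L: "2 \<le> L" and mass: "mass_condition \<X> P d Cd" and hoelder: "hoelder_condition \<X> L \<eta> lam \<alpha>"
    and margin: "margin_condition \<X> L P \<eta> \<beta> C\<beta>"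
    and \<kappa>: "nn_rule \<X> n \<kappa>" and \<nu>: "nn_rule \<X> n \<nu>"
    and \<rho>: "tie_rule L \<rho>" and \<sigma>: "tie_rule L \<sigma>" and \<tau>: "tie_rule L \<tau>"
    and k: "k \<in> {1..n}" and m: "1 \<le> m" "m \<le> n" and I: "1 \<le> I"
    and pos: "0 < \<epsilon>" "0 < r" "0 < s"
    and t: "2 * (\<epsilon> + lam * (2 * r) powr \<alpha>) + 2 * (lam * (2 * s) powr \<alpha>) \<le> t"
  obtains G where "G \<in> sets (draw P n m I)"
    "measure (draw P n m I) G \<ge> 1 - (2 ^ d / (Cd * r ^ d) * exp (real k - real n * (Cd * r ^ d) / 2)
      + 2 * real n * real L * exp (- (2 * real k * \<epsilon>\<^sup>2))
      + real L * (2 ^ d / (Cd * s ^ d) * exp (1 - real m * (Cd * s ^ d) / 2)))"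
    "\<And>\<omega>. \<omega> \<in> G \<Longrightarrow> err P (subnn \<sigma> \<tau> \<kappa> \<nu> L n k I (fst \<omega>) (snd \<omega>)) - err P (bayes \<rho> L \<eta>)
      \<le> C\<beta> * t powr (\<beta> + 1)"
proof -
  let ?D = "draw P n m I"
  interpret D: prob_space ?D by (rule prob_space_draw[OF m(2)])
  have L1: "1 \<le> L" using L by simp
  have lam: "0 < lam" using hoelder by (simp add: hoelder_condition_def)
  obtain E where E: "E \<in> sets (\<Pi>\<^sub>M i\<in>{1..n}. P)"
    "measure (\<Pi>\<^sub>M i\<in>{1..n}. P) E \<le> 2 ^ d / (Cd * r ^ d) * exp (real k - real n * (Cd * r ^ d) / 2)
      + 2 * real n * real L * exp (- (2 * real k * \<epsilon>\<^sup>2))"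
    and est: "\<And>zs j l. zs \<in> space (\<Pi>\<^sub>M i\<in>{1..n}. P) - E \<Longrightarrow> j \<in> {1..n} \<Longrightarrow> l \<in> {1..L} \<Longrightarrow>
      \<bar>knn_estimate \<kappa> n k zs (fst (zs j)) l - \<eta> (fst (zs j)) l\<bar> \<le> \<epsilon> + lam * (2 * r) powr \<alpha>"
    by (rule knn_estimate_at_sample[OF mass hoelder \<kappa> k pos(1,2)]) (rule that)
  let ?p = "2 ^ d / (Cd * s ^ d) * exp (1 - real m * (Cd * s ^ d) / 2)"
  define good where "good J F \<longleftrightarrow> F \<in> sets (\<Pi>\<^sub>M i\<in>{1..n}. P) \<and> measure (\<Pi>\<^sub>M i\<in>{1..n}. P) F \<le> ?p \<and>
    (\<forall>zs\<in>space (\<Pi>\<^sub>M i\<in>{1..n}. P) - F. \<forall>x\<in>\<X>. 1 \<le> card {i \<in> J. dist x (fst (zs i)) \<le> 2 * s})"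
    for J F
  have "\<forall>J\<in>index_sets n m. \<exists>F. good J F"
  proof
    fix J assume "J \<in> index_sets n m"
    then have J: "J \<subseteq> {1..n}" "card J = m" "1 \<le> card J" using m by auto
    obtain F where "F \<in> sets (\<Pi>\<^sub>M i\<in>{1..n}. P)" "measure (\<Pi>\<^sub>M i\<in>{1..n}. P) F \<le> ?p"
      "\<And>zs x. zs \<in> space (\<Pi>\<^sub>M i\<in>{1..n}. P) - F \<Longrightarrow> x \<in> \<X> \<Longrightarrow>
        1 \<le> card {i \<in> J. dist x (fst (zs i)) \<le> 2 * s}"
      by (rule uniform_cover[OF mass finite_atLeastAtMost J(1,3) pos(3), unfolded J(2) of_nat_1])
        (rule that)
    then show "\<exists>F. good J F" unfolding good_def by blast
  qed
  \<comment> \<open>An exceptional set of samples is attached to every possible index set in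
    advance, so that the random choice of \<open>J\<close> can be inserted afterwards.\<close>
  from bchoice[OF this] obtain F where good: "\<forall>J\<in>index_sets n m. good J (F J)" ..
  then have F: "\<And>J. J \<in> index_sets n m \<Longrightarrow> F J \<in> sets (\<Pi>\<^sub>M i\<in>{1..n}. P)"
    "\<And>J. J \<in> index_sets n m \<Longrightarrow> measure (\<Pi>\<^sub>M i\<in>{1..n}. P) (F J) \<le> ?p"
    unfolding good_def by blast+
  have near: "1 \<le> card {i \<in> J. dist x (fst (zs i)) \<le> 2 * s}"
    if "J \<in> index_sets n m" "zs \<in> space (\<Pi>\<^sub>M i\<in>{1..n}. P) - F J" "x \<in> \<X>" for J zs x
    using good that unfolding good_def by blast
  define A where "A = {\<omega> \<in> space ?D. fst \<omega> \<in> E}"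
  define B where "B = {\<omega> \<in> space ?D. I \<le> L * card {i \<in> {1..I}. fst \<omega> \<in> F (snd \<omega> i)}}"
  \<comment> \<open>This event concerns the sample only. The lemma on subsamples, applied to a
    constant family, carries it over to the joint law; the index 1 exists as
    \<open>I \<ge> 1\<close>.\<close>
  have A: "A \<in> D.events" "D.prob A \<le> 2 ^ d / (Cd * r ^ d) * exp (real k - real n * (Cd * r ^ d) / 2)
      + 2 * real n * real L * exp (- (2 * real k * \<epsilon>\<^sup>2))"
    unfolding A_def using I E by (intro draw_bad_subsample[OF m(2), of 1 I "\<lambda>_. E"]; simp)+
  have B: "B \<in> D.events" "D.prob B \<le> real L * ?p"
    unfolding B_def by (rule draw_many_bad_subsamples[OF m(2) I L1 F]; assumption)+
  show ?thesis
  proof (rule that[of "space ?D - (A \<union> B)"])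
    show "space ?D - (A \<union> B) \<in> D.events" using A(1) B(1) by auto
    have "D.prob (A \<union> B) \<le> D.prob A + D.prob B" using A(1) B(1) by (rule measure_Un_le)
    moreover have "D.prob (space ?D - (A \<union> B)) = 1 - D.prob (A \<union> B)"
      using A(1) B(1) by (intro D.prob_compl) auto
    ultimately show "D.prob (space ?D - (A \<union> B)) \<ge>
      1 - (2 ^ d / (Cd * r ^ d) * exp (real k - real n * (Cd * r ^ d) / 2)
      + 2 * real n * real L * exp (- (2 * real k * \<epsilon>\<^sup>2)) + real L * ?p)"
      using A(2) B(2) by linarith
    fix \<omega> assume \<omega>: "\<omega> \<in> space ?D - (A \<union> B)"
    define zs Js where "zs = fst \<omega>" and "Js = snd \<omega>"
    have zs: "zs \<in> space (\<Pi>\<^sub>M i\<in>{1..n}. P)" and Js: "\<And>i. i \<in> {1..I} \<Longrightarrow> Js i \<in> index_sets n m"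
      using \<omega> by (auto simp: zs_def Js_def space_draw mem_Times_iff PiE_iff)
    have zE: "zs \<in> space (\<Pi>\<^sub>M i\<in>{1..n}. P) - E" using \<omega> zs by (auto simp: A_def zs_def)
    define bad where "bad = {i \<in> {1..I}. zs \<in> F (Js i)}"
    have bad: "L * card bad < card {1..I}" "finite bad"
      using \<omega> by (auto simp: B_def zs_def Js_def bad_def not_le)
    let ?vote = "\<lambda>i x. denoised_1nn \<tau> \<kappa> \<nu> L n k zs (Js i) x"
    have vote: "?vote i x \<in> {1..L}" for i x
      unfolding denoised_1nn_def knn_classifier_def using argmax_label(1)[OF \<tau> L1] .
    have "\<eta> x l \<le> \<eta> x (subnn \<sigma> \<tau> \<kappa> \<nu> L n k I zs Js x) + t" if x: "x \<in> \<X>" and l: "l \<in> {1..L}" for x l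
    proof -
      obtain i where i: "i \<in> {1..I}" "i \<notin> bad"
        and win: "?vote i x = argmax_label \<sigma> L (\<lambda>l. real (card {i \<in> {1..I}. ?vote i x = l}))"
        by (rule plurality_voter[where h = "\<lambda>i. ?vote i x", OF \<sigma> L1 finite_atLeastAtMost vote bad])
          (rule that)
      have J: "Js i \<subseteq> {1..n}" "1 \<le> card (Js i)" using Js[OF i(1)] m by auto
      have "1 \<le> card {i' \<in> Js i. dist x (fst (zs i')) \<le> 2 * s}"
        using near[OF Js[OF i(1)] _ x, of zs] zs i by (auto simp: bad_def)
      from denoised_1nn_near_optimal[OF L1 hoelder \<nu> \<tau> J zs est[OF zE] x this l]
      show ?thesis using t unfolding subnn_def win[symmetric] by linarith
    qed
    moreover have "0 < t"
    proof -
      have "0 < 2 * (\<epsilon> + lam * (2 * r) powr \<alpha>) + 2 * (lam * (2 * s) powr \<alpha>)"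
        using pos lam by (intro add_pos_nonneg mult_pos_pos) simp_all
      then show ?thesis using t by (rule less_le_trans)
    qed
    moreover have "(\<lambda>x. subnn \<sigma> \<tau> \<kappa> \<nu> L n k I zs Js x) \<in> measurable MX (count_space UNIV)"
      unfolding zs_def Js_def using \<omega>
      by (intro measurable_subnn[OF \<kappa> \<nu> k m(1), of "\<lambda>_. \<omega>" MX I "\<lambda>x. x"] measurable_const measurable_ident) auto
    moreover have "subnn \<sigma> \<tau> \<kappa> \<nu> L n k I zs Js x \<in> {1..L}" for x
      unfolding subnn_def using argmax_label(1)[OF \<sigma> L1] .
    ultimately show "err P (subnn \<sigma> \<tau> \<kappa> \<nu> L n k I (fst \<omega>) (snd \<omega>)) - err P (bayes \<rho> L \<eta>)
        \<le> C\<beta> * t powr (\<beta> + 1)"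
      unfolding zs_def[symmetric] Js_def[symmetric] by (intro regret_le[OF L margin \<rho>]) auto
  qed
qed


text \<open>The radii are defined by the mass they guarantee, so that the failure probabilities
  become expressions in \<open>k / n\<close> and \<open>v\<close>. The condition
  \<open>u \<le> 1\<close> keeps \<open>k\<close> within the sample size.\<close>

lemma subnn_rate:
  assumes L: "2 \<le> L" and mass: "mass_condition \<X> P d Cd" and hoelder: "hoelder_condition \<X> L \<eta> lam \<alpha>"
    and margin: "margin_condition \<X> L P \<eta> \<beta> C\<beta>"
    and \<kappa>: "nn_rule \<X> n \<kappa>" and \<nu>: "nn_rule \<X> n \<nu>"
    and \<rho>: "tie_rule L \<rho>" and \<sigma>: "tie_rule L \<sigma>" and \<tau>: "tie_rule L \<tau>"
    and m: "1 \<le> m" "m \<le> n" and I: "1 \<le> I" and \<delta>: "0 < \<delta>" "\<delta> \<le> 1 / 2"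
  defines "c1 \<equiv> 2 + 2 * lam * (2 * (4 * (real d + 2) / Cd) powr (1 / real d)) powr \<alpha>"
    and "c2 \<equiv> 2 * lam * (2 * (2 * (real d + real L + 3) / Cd) powr (1 / real d)) powr \<alpha>"
    and "u \<equiv> ln (real L * real n / \<delta>) / real n" and "v \<equiv> ln (real m / \<delta>) / real m"
  assumes u1: "u \<le> 1"
  obtains k G where "k \<in> {1..n}" "G \<in> sets (draw P n m I)"
    "measure (draw P n m I) G \<ge> 1 - real L * \<delta>"
    "\<And>\<omega>. \<omega> \<in> G \<Longrightarrow> err P (subnn \<sigma> \<tau> \<kappa> \<nu> L n k I (fst \<omega>) (snd \<omega>)) - err P (bayes \<rho> L \<eta>)
      \<le> C\<beta> * (c1 * u powr (\<alpha> / (2 * \<alpha> + real d)) + c2 * v powr (\<alpha> / real d)) powr (\<beta> + 1)"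
proof -
  define l where "l = ln (real L * real n / \<delta>)"
  have n: "1 \<le> n" using m by simp
  have d: "1 \<le> d" and Cd: "0 < Cd" using mass by (simp_all add: mass_condition_def)
  have \<alpha>: "0 < \<alpha>" and lam: "0 < lam" using hoelder by (simp_all add: hoelder_condition_def)
  have "2 * 1 \<le> real L * real n" using n L by (intro mult_mono) auto
  \<comment> \<open>The bound \<delta> \<le> 1 / 2 makes the logarithm at least ln 4 > 1, as the
    choice of \<open>k\<close> requires.\<close>
  then have "4 \<le> real L * real n / \<delta>" using \<delta> by (simp add: pos_le_divide_eq)
  then have "ln 4 \<le> l" unfolding l_def by simp
  moreover have "ln (4::real) = 2 * ln 2" using ln_realpow[of 2 2] by simp
  ultimately have l: "1 \<le> l" "l \<le> real n"
    using ln2_ge_two_thirds u1 n by (simp_all add: u_def l_def)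
  define \<gamma> where "\<gamma> = 2 * \<alpha> + real d"
  obtain k where k: "k \<in> {1..n}" "l \<le> real k" "real k \<le> 2 * real n * u powr (real d / \<gamma>)"
    and sqrt: "sqrt (l / real k) \<le> u powr (\<alpha> / \<gamma>)"
    using neighbors_choice[OF n l \<alpha> d] unfolding u_def l_def[symmetric] \<gamma>_def by blast
  have k0: "0 < real k" using k l by simp
  have v0: "0 < v" using m \<delta> by (simp add: v_def)
  \<comment> \<open>These are the target values of \<open>Cd * r ^ d\<close> and
    \<open>Cd * s ^ d\<close>; their constants are those for which the exponential tails beat the
    sizes of the nets.\<close>
  define a where "a = 2 * (real d + 2) * real k / real n"
  define b where "b = 2 * (real d + real L + 3) * v"
  define r s where "r = (a / Cd) powr (1 / real d)" and "s = (b / Cd) powr (1 / real d)"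
  have a0: "0 < a" and b0: "0 < b" using k0 n v0 by (auto simp: a_def b_def intro!: mult_pos_pos)
  have r: "Cd * r ^ d = a" and s: "Cd * s ^ d = b"
    using a0 b0 Cd d by (simp_all add: r_def s_def powr_root_power)
  \<comment> \<open>Chosen so that \<open>k * \<epsilon>\<^sup>2\<close> is the logarithm
    \<open>l\<close>, which makes the Hoeffding exponent \<open>- 2 * l\<close>.\<close>
  define \<epsilon> where "\<epsilon> = sqrt (l / real k)"
  have \<epsilon>: "real k * \<epsilon>\<^sup>2 = l" using k0 l by (simp add: \<epsilon>_def)
  have pos: "0 < \<epsilon>" "0 < r" "0 < s" using k0 l a0 b0 Cd by (simp_all add: \<epsilon>_def r_def s_def)
  \<comment> \<open>The upper bound on \<open>k\<close> turns 2 * (d + 2) into the 4 * (d + 2) of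
    \<open>c1\<close>. The bias obtains the same power of \<open>u\<close> as the deviation
    \<epsilon>.\<close>
  have ub: "(2 * r) powr \<alpha> \<le> (2 * (4 * (real d + 2) / Cd) powr (1 / real d)) powr \<alpha> * u powr (\<alpha> / \<gamma>)"
  proof -
    have "a / Cd \<le> 4 * (real d + 2) / Cd * u powr (real d / \<gamma>)"
    proof -
      have "a \<le> 2 * (real d + 2) * (2 * real n * u powr (real d / \<gamma>)) / real n"
        unfolding a_def using k(3) by (intro divide_right_mono mult_left_mono) auto
      also have "\<dots> = 4 * (real d + 2) * u powr (real d / \<gamma>)" using n by simp
      finally have "a / Cd \<le> 4 * (real d + 2) * u powr (real d / \<gamma>) / Cd"
        using Cd by (intro divide_right_mono) auto
      then show ?thesis by simp
    qed
    then have "r \<le> (4 * (real d + 2) / Cd * u powr (real d / \<gamma>)) powr (1 / real d)"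
      unfolding r_def using a0 Cd by (intro powr_mono2) auto
    then have "(2 * r) powr \<alpha> \<le> (2 * (4 * (real d + 2) / Cd * u powr (real d / \<gamma>)) powr (1 / real d)) powr \<alpha>"
      using pos \<alpha> by (intro powr_mono2) auto
    also have "\<dots> = (2 * (4 * (real d + 2) / Cd) powr (1 / real d)) powr \<alpha> * (u powr (real d / \<gamma>)) powr (\<alpha> / real d)"
      using Cd by (intro powr_scaled_root) auto
    also have "(u powr (real d / \<gamma>)) powr (\<alpha> / real d) = u powr (\<alpha> / \<gamma>)"
      using d by (simp add: powr_powr)
    finally show ?thesis .
  qed
  have vb: "(2 * s) powr \<alpha> = (2 * (2 * (real d + real L + 3) / Cd) powr (1 / real d)) powr \<alpha> * v powr (\<alpha> / real d)"
    unfolding s_def b_def times_divide_eq_left[symmetric] using Cd v0 by (intro powr_scaled_root) auto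
  have t: "2 * (\<epsilon> + lam * (2 * r) powr \<alpha>) + 2 * (lam * (2 * s) powr \<alpha>)
      \<le> c1 * u powr (\<alpha> / \<gamma>) + c2 * v powr (\<alpha> / real d)"
  proof -
    define A where "A = (2 * (4 * (real d + 2) / Cd) powr (1 / real d)) powr \<alpha>"
    have *: "2 * (e + x) + 2 * y \<le> c + z"
      if "x \<le> w" "c = 2 * U + 2 * w" "z = 2 * y" "e \<le> U" for e x y c z w U :: real
      using that by simp
    have "lam * (2 * r) powr \<alpha> \<le> lam * (A * u powr (\<alpha> / \<gamma>))"
      using ub lam unfolding A_def by (intro mult_left_mono) simp_all
    moreover have "c1 * u powr (\<alpha> / \<gamma>) = 2 * u powr (\<alpha> / \<gamma>) + 2 * (lam * (A * u powr (\<alpha> / \<gamma>)))"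
      unfolding c1_def A_def[symmetric] by (simp add: algebra_simps)
    moreover have "c2 * v powr (\<alpha> / real d) = 2 * (lam * (2 * s) powr \<alpha>)"
      unfolding vb c2_def by (simp only: mult.assoc)
    ultimately show ?thesis using sqrt unfolding \<epsilon>_def[symmetric] by (rule *)
  qed
  obtain G where G: "G \<in> sets (draw P n m I)"
    "measure (draw P n m I) G \<ge> 1 - (2 ^ d / a * exp (real k - real n * a / 2)
      + 2 * real n * real L * exp (- (2 * real k * \<epsilon>\<^sup>2)) + real L * (2 ^ d / b * exp (1 - real m * b / 2)))"
    "\<And>\<omega>. \<omega> \<in> G \<Longrightarrow> err P (subnn \<sigma> \<tau> \<kappa> \<nu> L n k I (fst \<omega>) (snd \<omega>)) - err P (bayes \<rho> L \<eta>)
      \<le> C\<beta> * (c1 * u powr (\<alpha> / \<gamma>) + c2 * v powr (\<alpha> / real d)) powr (\<beta> + 1)"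
    by (rule subnn_regret[OF L mass hoelder margin \<kappa> \<nu> \<rho> \<sigma> \<tau> k(1) m I pos t, unfolded r s]) (rule that)
  have "2 ^ d / a * exp (real k - real n * a / 2) \<le> \<delta> / 2"
    using sample_failure_le[OF n L \<delta>, of k d] k by (simp only: a_def l_def atLeastAtMost_iff)
  moreover have "2 * real n * real L * exp (- (2 * real k * \<epsilon>\<^sup>2)) \<le> \<delta> / 2"
    using deviation_failure_le[OF n L \<delta>] unfolding l_def[symmetric] \<epsilon>[symmetric] by (simp only: mult.assoc)
  moreover have "real L * (2 ^ d / b * exp (1 - real m * b / 2)) \<le> \<delta>"
    using subsample_failure_le[OF m(1) \<delta>, of L d] by (simp only: b_def v_def)
  moreover have "2 * \<delta> \<le> real L * \<delta>" using L \<delta> by (intro mult_right_mono) auto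
  ultimately have "1 - real L * \<delta> \<le> measure (draw P n m I) G" using G(2) by linarith
  then show ?thesis using that[OF k(1) G(1) _ G(3)[unfolded \<gamma>_def]] by blast
qed

end

theorem theorem1:
  fixes \<X> :: "(real ^ 'D) set"
    and P :: "((real ^ 'D) \<times> nat) measure"
    and \<eta> :: "real ^ 'D \<Rightarrow> nat \<Rightarrow> real"
    and L d :: nat
    and Cd lam \<alpha> \<beta> C\<beta> :: real
  assumes "L \<ge> 2"
    and "prob_space P" and "sets P = sets (xy_space \<X> L)"
    and "regression_function \<X> L P \<eta>"
    and "mass_condition \<X> P d Cd"
    and "hoelder_condition \<X> L \<eta> lam \<alpha>"
    and "margin_condition \<X> L P \<eta> \<beta> C\<beta>"
  defines "V \<equiv> real (the_enat (vc_dim (balls_in \<X>)))"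
  shows "\<exists>C1 C2 :: real. \<forall>(n::nat) (m::nat) (I::nat) (\<delta>::real) \<kappa> \<nu> \<rho> \<sigma> \<tau>.
    1 \<le> n \<and> 1 \<le> m \<and> m \<le> n \<and> 1 \<le> I \<and> 0 < \<delta> \<and> \<delta> < 1 \<and>
    nn_rule \<X> n \<kappa> \<and> nn_rule \<X> n \<nu> \<and> tie_rule L \<rho> \<and> tie_rule L \<sigma> \<and> tie_rule L \<tau> \<longrightarrow>
    measure (draw P n m I)
      {(zs, Js) \<in> space (draw P n m I). \<exists>k\<in>{1..n}.
         err P (subnn \<sigma> \<tau> \<kappa> \<nu> L n k I zs Js) - err P (bayes \<rho> L \<eta>)
           \<le> C1 * (V * ln (real L * real n / \<delta>) / real n) powr (\<alpha> * (\<beta> + 1) / (2 * \<alpha> + real d))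
             + C2 * (V * ln (real m / \<delta>) / real m) powr (\<alpha> * (\<beta> + 1) / real d)}
    \<ge> 1 - real L * \<delta>"
proof -
  interpret prob_space P by fact
  interpret classification P \<X> L \<eta> by unfold_locales fact+
  have L: "2 \<le> L" and mass: "mass_condition \<X> P d Cd" and hoelder: "hoelder_condition \<X> L \<eta> lam \<alpha>"
    and margin: "margin_condition \<X> L P \<eta> \<beta> C\<beta>" by fact+
  have \<alpha>: "0 < \<alpha>" and lam: "0 < lam" using hoelder by (simp_all add: hoelder_condition_def)
  have \<beta>: "0 < \<beta>" and C\<beta>: "0 < C\<beta>" using margin by (simp_all add: margin_condition_def)
  have V: "1 \<le> V" using vc_dim_balls_in_ge_1[of \<X>] mass by (simp add: V_def mass_condition_def)
  define c1 where "c1 = 2 + 2 * lam * (2 * (4 * (real d + 2) / Cd) powr (1 / real d)) powr \<alpha>"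
  define c2 where "c2 = 2 * lam * (2 * (2 * (real d + real L + 3) / Cd) powr (1 / real d)) powr \<alpha>"
  have c: "0 \<le> c1" "0 \<le> c2" using lam by (simp_all add: c1_def c2_def)
  define C where "C = C\<beta> * 2 powr (\<beta> + 1)"
  have C: "0 \<le> C" using C\<beta> by (simp add: C_def)
  \<comment> \<open>The lower bound 1 makes the right side trivially large when the logarithm
    exceeds \<open>n\<close>.\<close>
  define C1 where "C1 = max 1 (C * c1 powr (\<beta> + 1))"
  define C2 where "C2 = C * c2 powr (\<beta> + 1)"
  have goal: "measure (draw P n m I)
      {(zs, Js) \<in> space (draw P n m I). \<exists>k\<in>{1..n}.
         err P (subnn \<sigma> \<tau> \<kappa> \<nu> L n k I zs Js) - err P (bayes \<rho> L \<eta>)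
           \<le> C1 * (V * ln (real L * real n / \<delta>) / real n) powr (\<alpha> * (\<beta> + 1) / (2 * \<alpha> + real d))
             + C2 * (V * ln (real m / \<delta>) / real m) powr (\<alpha> * (\<beta> + 1) / real d)}
    \<ge> 1 - real L * \<delta>" (is "measure ?D ?S \<ge> _")
    if n: "1 \<le> n" and m: "1 \<le> m" "m \<le> n" and I: "1 \<le> I" and \<delta>: "0 < \<delta>" "\<delta> < 1"
      and \<kappa>: "nn_rule \<X> n \<kappa>" and \<nu>: "nn_rule \<X> n \<nu>"
      and \<rho>: "tie_rule L \<rho>" and \<sigma>: "tie_rule L \<sigma>" and \<tau>: "tie_rule L \<tau>"
    for n m I :: nat and \<delta> :: real and \<kappa> \<nu> \<rho> \<sigma> \<tau>
  proof (cases "\<delta> \<le> 1 / 2")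
    case False
    then have "2 * (1 / 2) \<le> real L * \<delta>" using L by (intro mult_mono) auto
    then show ?thesis using measure_nonneg[of ?D ?S] by linarith
  next
    case True
    interpret D: prob_space ?D by (rule prob_space_draw[OF m(2)])
    define u v where "u = ln (real L * real n / \<delta>) / real n" and "v = ln (real m / \<delta>) / real m"
    define p q where "p = \<alpha> / (2 * \<alpha> + real d)" and "q = \<alpha> / real d"
    define R where "R = C1 * (V * u) powr (p * (\<beta> + 1)) + C2 * (V * v) powr (q * (\<beta> + 1))"
    have S: "?S = {\<omega> \<in> space ?D. \<exists>k\<in>{1..n}.
        err P (subnn \<sigma> \<tau> \<kappa> \<nu> L n k I (fst \<omega>) (snd \<omega>)) - err P (bayes \<rho> L \<eta>) \<le> R}"
      by (auto simp: R_def u_def v_def p_def q_def)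
    have p: "0 < p" "0 \<le> q" using \<alpha> by (auto simp: p_def q_def intro!: divide_pos_pos add_pos_nonneg)
    have "1 * 1 \<le> real L * real n" using n L by (intro mult_mono) auto
    then have "1 \<le> real L * real n / \<delta>" using \<delta> by (simp add: pos_le_divide_eq)
    then have u0: "0 \<le> u" by (simp add: u_def)
    have v0: "0 \<le> v" using m \<delta> by (simp add: v_def pos_le_divide_eq)
    have Vu: "u \<le> V * u" "v \<le> V * v" using V u0 v0 by (simp_all add: mult_le_cancel_right1)
    show ?thesis
    proof (cases "u \<le> 1")
      \<comment> \<open>The first term alone is at least 1 because \<open>V * u \<ge> u > 1\<close>,
        and two error probabilities differ by at most 1, so any \<open>k\<close> will do.\<close>
      case False
      have "1 \<le> R"
      proof -
        have "1 \<le> (V * u) powr (p * (\<beta> + 1))" 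
        proof (rule ge_one_powr_ge_zero)
          show "1 \<le> V * u" using False Vu by linarith
        qed (use p \<beta> in simp)
        then have "1 * 1 \<le> C1 * (V * u) powr (p * (\<beta> + 1))" by (intro mult_mono) (auto simp: C1_def)
        moreover have "0 \<le> C2 * (V * v) powr (q * (\<beta> + 1))" using C by (simp add: C2_def)
        ultimately show ?thesis by (simp add: R_def)
      qed
      then have "err P h - err P h' \<le> R" for h h' :: "real ^ 'D \<Rightarrow> nat"
        using err_diff_le_1[of h h'] by linarith
      then have "?S = space ?D" unfolding S using n by auto
      then show ?thesis using \<delta> by (simp only: D.prob_space) simp
    next
      case u1: True
      obtain k G where k: "k \<in> {1..n}" and G: "G \<in> D.events" "1 - real L * \<delta> \<le> D.prob G"
        "\<And>\<omega>. \<omega> \<in> G \<Longrightarrow> err P (subnn \<sigma> \<tau> \<kappa> \<nu> L n k I (fst \<omega>) (snd \<omega>)) - err P (bayes \<rho> L \<eta>)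
          \<le> C\<beta> * (c1 * u powr p + c2 * v powr q) powr (\<beta> + 1)"
        by (rule subnn_rate[OF L mass hoelder margin \<kappa> \<nu> \<rho> \<sigma> \<tau> m I \<delta>(1) True u1[unfolded u_def],
              folded u_def v_def c1_def c2_def p_def q_def]) (rule that)
      \<comment> \<open>Splitting the power of the sum costs 2^(\<beta> + 1), which is part of
        \<open>C\<close>. The VC dimension is inserted by monotonicity, from
        \<open>u \<le> V * u\<close> and \<open>v \<le> V * v\<close>.\<close>
      have "C\<beta> * (c1 * u powr p + c2 * v powr q) powr (\<beta> + 1) \<le>
        C\<beta> * (2 powr (\<beta> + 1) * ((c1 * u powr p) powr (\<beta> + 1) + (c2 * v powr q) powr (\<beta> + 1)))"
        using C\<beta> c \<beta> by (intro mult_left_mono powr_sum_le) auto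
      also have "\<dots> = C * c1 powr (\<beta> + 1) * u powr (p * (\<beta> + 1)) + C2 * v powr (q * (\<beta> + 1))"
        using c by (simp add: C_def C2_def powr_mult powr_powr algebra_simps)
      also have "\<dots> \<le> R"
        unfolding R_def using u0 v0 Vu p \<beta> C
        by (intro add_mono mult_mono powr_mono2) (auto simp: C1_def C2_def)
      finally have "G \<subseteq> ?S"
        unfolding S using G(3) k sets.sets_into_space[OF G(1)] by (blast intro: order_trans)
      moreover have "?S \<in> D.events"
      proof -
        have [measurable]: "(\<lambda>\<omega>. err P (subnn \<sigma> \<tau> \<kappa> \<nu> L n k I (fst \<omega>) (snd \<omega>))) \<in> borel_measurable ?D"
          if "k \<in> {1..n}" for k
          using measurable_err_subnn[OF \<kappa> \<nu> that m(1)] .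
        show ?thesis unfolding S by measurable
      qed
      ultimately have "D.prob G \<le> D.prob ?S" by (rule D.finite_measure_mono)
      then show ?thesis using G(2) by simp
    qed
  qed
  show ?thesis
    by (rule exI[of _ C1], rule exI[of _ C2]) (use goal in blast)
qed

end
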